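(* Let $G(x)=(G_1(x),G_2(x))$, $x\ge0$, where $G_1,G_2$ are continuous functions on $[0,+\infty)$ such that $G_1(x)>0$, $G_2(x)>0$ for $x>0$ and $\frac{G_2(\cdot)}{G_1(\cdot)}\in C^1(0,+\infty)$. Let $Z(t)=(Z_1(t),Z_2(t))$ be a Lévy martingale with nonnegative jumps and with independent coordinates of infinite variation, whose Laplace exponents vary regularly at zero with indices $\alpha_1,\alpha_2$, respectively, where $2\ge\alpha_1\ge\alpha_2>1$. I) If $\tilde J_\mu$ is of the form $\tilde J_\mu(\beta)=\eta_1\beta^{\alpha_1}$, $\beta\ge0$, with $\eta_1>0$, $1<\alpha_1\le2$, then $(G,Z)$ is a generating pair if and only if one of the following two cases holds: a) $G(x)=c_0x^{1/\alpha_1}\begin{pmatrix}\gamma_1\\ \gamma_2\end{pmatrix}$, $x\ge0$, where $c_0=\left(\frac{\eta_1}{c_{\alpha_1}}\right)^{1/\alpha_1}$, $\gamma_1>0$, $\gamma_2>0$ are constants and the process $\gamma_1Z_1(t)+\gamma_2Z_2(t)$, $t\ge0$, is $\alpha_1$-stable; b) $G$ is such that $c_1G_1^{\alpha_1}(x)+c_2G_2^{\alpha_1}(x)=\eta_1x$, $x\ge0$, with some constants $c_1,c_2>0$, and $Z_1,Z_2$ are $\alpha_1$-stable processes. II) If $\tilde J_\mu$ is of the form $\tilde J_\mu(\beta)=\eta_1\beta^{\alpha_1}+\eta_2\beta^{\alpha_2}$, $\beta\ge0$, with $\eta_1,\eta_2>0$, $2\ge\alpha_1>\alpha_2>1$,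 then $(G,Z)$ is a generating pair if and only if $$G_1(x)=\left(\frac{\eta_1}{c_1}x\right)^{1/\alpha_1},\qquad G_2(x)=\left(\frac{\eta_2}{d_2}x\right)^{1/\alpha_2},\qquad x\ge0,$$ with some $c_1,d_2>0$, and $Z_1$ is $\alpha_1$-stable, $Z_2$ is $\alpha_2$-stable.
   Context: Laplace exponents: for a real Lévy martingale $X$, $J_X$ is defined by $\mathbb{E}[e^{-\lambda X(t)}]=e^{tJ_X(\lambda)}$. For $Z_i$ with nonnegative jumps, $J_i(\beta)=\frac12q_{ii}\beta^2+\int_0^{+\infty}(e^{-\beta v}-1+\beta v)\nu_i(dv)$, $\beta\ge0$, where $q_{ii}\ge 0$ is the variance of the Wiener part and $\nu_i$ the Lévy measure of $Z_i$. $J_i$ varies regularly at zero with index $\alpha$ if $\lim_{x\to0^+}J_i(\beta x)/J_i(x)=\beta^\alpha$ for all $\beta>0$. An $\alpha$-stable process ($\alpha\in(1,2]$) here is a Lévy martingale with nonnegative jumps and Laplace exponent $\gamma\beta^\alpha$, $\beta\ge0$, for some $\gamma>0$. In I a), $c_{\alpha_1}$ is the number given by $c_2=\frac12$ when $\alpha_1=2$ and $c_\alpha=\frac{\Gamma(2-\alpha)}{\alpha(\alpha-1)}$ when $\alpha=\alpha_1\in(1,2)$, with $\Gamma$ the Gamma function; the constants $c_1,c_2,d_2$ in I b) and II are unrelated to this notation. Generating pairs: for $x\ge0$ let $Z^{G(x)}(t)=\langle G(x),Z(t)\rangle$, let $Q$ and $\nu$ be the covariance matrix of the Wiener part and the Lévy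 measure of $Z$, and let $\nu_{G(x)}(A)=\nu\{y:\langle G(x),y\rangle\in A\}$. $(G,Z)$ is a generating pair if: $\langle G(x),\triangle Z(t)\rangle\ge0$ a.s. for all $x,t\ge0$; $\int_{(0,+\infty)}v\,\nu_{G(0)}(dv)<+\infty$; and there are $c\ge0$ and a measure $\mu$ on $(0,+\infty)$ with $\int_{(0,+\infty)}(v\wedge v^2)\mu(dv)<+\infty$ such that $\frac12\langle QG(x),G(x)\rangle=cx$ and $\nu_{G(x)}|_{(0,+\infty)}=\nu_{G(0)}|_{(0,+\infty)}+x\mu$ for all $x\ge0$. For such a pair (here $G(0)=0$ necessarily, since the coordinates have infinite variation), $\tilde J_\mu(\beta):=c\beta^2+\int_0^{+\infty}(e^{-\beta v}-1+\beta v)\mu(dv)$, so that $J_1(\beta G_1(x))+J_2(\beta G_2(x))=x\tilde J_\mu(\beta)$ for all $\beta,x\ge0$. In I) and II), "generating pair" refers to a generating pair whose function $\tilde J_\mu$ is of the indicated form.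
   Formalization: The constants c_1, c_2, d_2 in I b) and II are required to be the coefficients in the Laplace exponents of the stable processes Z_1, Z_2, and in I a) the process γ_1Z_1+γ_2Z_2 has Laplace exponent c_{α_1}β^{α_1}; with unrelated constants the "if" direction fails. *)

theory Defs
  imports "HOL-Probability.Probability"
begin

section \<open>Levy martingales\<close>

text \<open>
  A process is a function \<open>X t \<omega>\<close> with times \<open>t :: real\<close>; only its values at \<open>t \<ge> 0\<close> matter.
\<close>

definition cadlag :: "(real \<Rightarrow> 'b::topological_space) \<Rightarrow> bool" where
  "cadlag f \<longleftrightarrow>
     (\<forall>t\<ge>0. (f \<longlongrightarrow> f t) (at_right t)) \<and> (\<forall>t>0. \<exists>l. (f \<longlongrightarrow> l) (at_left t))"

definition levy_process :: "'w measure \<Rightarrow> (real \<Rightarrow> 'w \<Rightarrow> 'b::euclidean_space) \<Rightarrow> bool" where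
  "levy_process M X \<longleftrightarrow>
     prob_space M \<and>
     (\<forall>t\<ge>0. X t \<in> borel_measurable M) \<and>
     (AE \<omega> in M. X 0 \<omega> = 0) \<and>
     (\<forall>(n::nat) (s::nat \<Rightarrow> real). 0 \<le> s 0 \<and> mono s \<longrightarrow>
        prob_space.indep_vars M (\<lambda>_. borel) (\<lambda>i \<omega>. X (s (Suc i)) \<omega> - X (s i) \<omega>) {..<n}) \<and>
     (\<forall>s\<ge>0. \<forall>h\<ge>0. distr M borel (\<lambda>\<omega>. X (s + h) \<omega> - X s \<omega>) = distr M borel (X h)) \<and>
     (AE \<omega> in M. cadlag (\<lambda>t. X t \<omega>))"

definition natural_filtration ::
    "'w measure \<Rightarrow> (real \<Rightarrow> 'w \<Rightarrow> 'b::topological_space) \<Rightarrow> real \<Rightarrow> 'w measure" where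
  "natural_filtration M X t =
     sigma (space M) {X s -` A \<inter> space M |s A. s \<in> {0..t} \<and> A \<in> sets borel}"

text \<open>
  Conditional expectations are available for real random variables only, so the martingale
  property is stated for each coordinate, with respect to the filtration of the whole process.
\<close>

definition levy_martingale :: "'w measure \<Rightarrow> (real \<Rightarrow> 'w \<Rightarrow> 'b::euclidean_space) \<Rightarrow> bool" where
  "levy_martingale M X \<longleftrightarrow>
     levy_process M X \<and>
     (\<forall>t\<ge>0. integrable M (X t)) \<and>
     (\<forall>b\<in>Basis. \<forall>s t. 0 \<le> s \<and> s \<le> t \<longrightarrow>
        (AE \<omega> in M. real_cond_exp M (natural_filtration M X s) (\<lambda>\<omega>. X t \<omega> \<bullet> b) \<omega> = X s \<omega> \<bullet> b))"

text \<open>The jump \<open>f t - f (t-)\<close> of a path; there is no jump at time \<open>0\<close>.\<close>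

definition jump :: "(real \<Rightarrow> 'b::real_normed_vector) \<Rightarrow> real \<Rightarrow> 'b" where
  "jump f t = (if t > 0 then f t - Lim (at_left t) f else 0)"

definition nonneg_jumps :: "'w measure \<Rightarrow> (real \<Rightarrow> 'w \<Rightarrow> real) \<Rightarrow> bool" where
  "nonneg_jumps M X \<longleftrightarrow> (AE \<omega> in M. \<forall>t\<ge>0. 0 \<le> jump (\<lambda>s. X s \<omega>) t)"

definition bounded_variation :: "(real \<Rightarrow> real) \<Rightarrow> real \<Rightarrow> bool" where
  "bounded_variation f T \<longleftrightarrow>
     (\<exists>B. \<forall>(n::nat) (s::nat \<Rightarrow> real). mono s \<and> range s \<subseteq> {0..T} \<longrightarrow>
        (\<Sum>i<n. \<bar>f (s (Suc i)) - f (s i)\<bar>) \<le> B)"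

text \<open>
  For a Levy process the paths are either almost surely of finite variation on all bounded
  intervals, or almost surely of infinite variation on all of them; infinite variation is
  therefore the failure of the first alternative.
\<close>

definition infinite_variation :: "'w measure \<Rightarrow> (real \<Rightarrow> 'w \<Rightarrow> real) \<Rightarrow> bool" where
  "infinite_variation M X \<longleftrightarrow> \<not> (AE \<omega> in M. \<forall>T\<ge>0. bounded_variation (\<lambda>t. X t \<omega>) T)"

definition independent_processes ::
    "'w measure \<Rightarrow> (real \<Rightarrow> 'w \<Rightarrow> real) \<Rightarrow> (real \<Rightarrow> 'w \<Rightarrow> real) \<Rightarrow> bool" where
  "independent_processes M X Y \<longleftrightarrow>
     prob_space.indep_var M
       (PiM {0..} (\<lambda>_. borel)) (\<lambda>\<omega>. \<lambda>t\<in>{0..}. X t \<omega>)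
       (PiM {0..} (\<lambda>_. borel)) (\<lambda>\<omega>. \<lambda>t\<in>{0..}. Y t \<omega>)"

section \<open>Laplace exponents, Levy measure and covariance of the Wiener part\<close>

text \<open>On a one-dimensional process \<open>\<lambda> \<bullet> X t \<omega>\<close> is the product \<open>\<lambda> * X t \<omega>\<close>.\<close>

definition has_laplace_exponent ::
    "'w measure \<Rightarrow> (real \<Rightarrow> 'w \<Rightarrow> 'b::euclidean_space) \<Rightarrow> 'b set \<Rightarrow> ('b \<Rightarrow> real) \<Rightarrow> bool" where
  "has_laplace_exponent M X D J \<longleftrightarrow>
     (\<forall>l\<in>D. \<forall>t\<ge>0. integrable M (\<lambda>\<omega>. exp (- (l \<bullet> X t \<omega>))) \<and>
        (\<integral>\<omega>. exp (- (l \<bullet> X t \<omega>)) \<partial>M) = exp (t * J l))"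

text \<open>
  The Levy measure of a set is the expected number of jumps that fall into it during a unit of
  time.
\<close>

definition is_levy_measure ::
    "'w measure \<Rightarrow> (real \<Rightarrow> 'w \<Rightarrow> 'b::euclidean_space) \<Rightarrow> 'b measure \<Rightarrow> bool" where
  "is_levy_measure M X \<nu> \<longleftrightarrow>
     sets \<nu> = sets borel \<and>
     (\<forall>A\<in>sets borel. emeasure \<nu> A =
        (\<integral>\<^sup>+\<omega>. emeasure (count_space UNIV) {t\<in>{0<..1}. jump (\<lambda>s. X s \<omega>) t \<in> A - {0}} \<partial>M))"

text \<open>
  \<open>Q\<close> and \<open>\<nu>\<close> are the covariance matrix of the Wiener part and the Levy measure of a Levy
  martingale \<open>Z\<close> with nonnegative jumps. The matrix \<open>Q\<close> is identified as the quadratic term in the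
  Levy-Khintchine formula
  \<open>J(\<lambda>) = 1/2 <Q \<lambda>, \<lambda>> + \<integral> (exp (- <\<lambda>, y>) - 1 + <\<lambda>, y>) \<nu>(dy)\<close>. This formula is
  stated on the nonnegative orthant, where the Laplace transform of such a process is finite, and
  there it determines the symmetric matrix \<open>Q\<close>.
\<close>

definition levy_characteristics ::
    "'w measure \<Rightarrow> (real \<Rightarrow> 'w \<Rightarrow> real^'n) \<Rightarrow> real^'n^'n \<Rightarrow> (real^'n) measure \<Rightarrow> bool" where
  "levy_characteristics M Z Q \<nu> \<longleftrightarrow>
     is_levy_measure M Z \<nu> \<and>
     (\<integral>\<^sup>+y. ennreal (min (norm y) ((norm y)\<^sup>2)) \<partial>\<nu>) < \<infinity> \<and>
     transpose Q = Q \<and> (\<forall>u. 0 \<le> (Q *v u) \<bullet> u) \<and>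
     has_laplace_exponent M Z {l. \<forall>i. 0 \<le> l $ i}
       (\<lambda>l. 1/2 * ((Q *v l) \<bullet> l) + (\<integral>y. exp (- (l \<bullet> y)) - 1 + l \<bullet> y \<partial>\<nu>))"

definition regularly_varying_at_0 :: "(real \<Rightarrow> real) \<Rightarrow> real \<Rightarrow> bool" where
  "regularly_varying_at_0 J \<alpha> \<longleftrightarrow>
     (\<forall>\<beta>>0. ((\<lambda>x. J (\<beta> * x) / J x) \<longlongrightarrow> \<beta> powr \<alpha>) (at_right 0))"

text \<open>
  \<open>X\<close> is an \<open>\<alpha>\<close>-stable process, with \<open>k\<close> the coefficient in its Laplace exponent
  \<open>k * \<beta> powr \<alpha>\<close>; it is \<open>\<alpha>\<close>-stable if this holds for some \<open>k\<close>. The coefficient is a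
  parameter because an identity such as
  \<open>c\<^sub>1 * G\<^sub>1 x powr \<alpha> + c\<^sub>2 * G\<^sub>2 x powr \<alpha> = \<eta> * x\<close> characterizes the generating pairs with the
  given \<open>\<eta>\<close> only if \<open>c\<^sub>1\<close> and \<open>c\<^sub>2\<close> are the coefficients of the driving stable processes.
\<close>

definition stable_process ::
    "'w measure \<Rightarrow> real \<Rightarrow> real \<Rightarrow> (real \<Rightarrow> 'w \<Rightarrow> real) \<Rightarrow> bool" where
  "stable_process M \<alpha> k X \<longleftrightarrow>
     1 < \<alpha> \<and> \<alpha> \<le> 2 \<and> 0 < k \<and>
     levy_martingale M X \<and> nonneg_jumps M X \<and>
     has_laplace_exponent M X {0..} (\<lambda>\<beta>. k * \<beta> powr \<alpha>)"

text \<open>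
  For \<open>\<alpha> < 2\<close> this is the coefficient that belongs to the Levy measure \<open>v powr (-1 - \<alpha>) dv\<close> on
  \<open>(0, \<infinity>)\<close>, for \<open>\<alpha> = 2\<close> the one of the standard Wiener process.
\<close>

definition c_stable :: "real \<Rightarrow> real" where
  "c_stable \<alpha> = (if \<alpha> = 2 then 1/2 else Gamma (2 - \<alpha>) / (\<alpha> * (\<alpha> - 1)))"

section \<open>Generating pairs\<close>

definition projected_measure :: "(real^'n) measure \<Rightarrow> real^'n \<Rightarrow> real measure" where
  "projected_measure \<nu> g = distr \<nu> borel (\<lambda>y. g \<bullet> y)"

text \<open>A measure \<open>\<mu>\<close> on \<open>(0, \<infinity>)\<close> is a Borel measure on the reals that vanishes on the rest.\<close>

definition generating_pair_with ::
    "'w measure \<Rightarrow> (real \<Rightarrow> 'w \<Rightarrow> real^'n) \<Rightarrow> real^'n^'n \<Rightarrow> (real^'n) measure \<Rightarrow> (real \<Rightarrow> real^'n)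
      \<Rightarrow> real \<Rightarrow> real measure \<Rightarrow> bool" where
  "generating_pair_with M Z Q \<nu> G c \<mu> \<longleftrightarrow>
     (AE \<omega> in M. \<forall>x\<ge>0. \<forall>t\<ge>0. 0 \<le> G x \<bullet> jump (\<lambda>s. Z s \<omega>) t) \<and>
     (\<integral>\<^sup>+v\<in>{0<..}. ennreal v \<partial>projected_measure \<nu> (G 0)) < \<infinity> \<and>
     0 \<le> c \<and>
     sets \<mu> = sets borel \<and> emeasure \<mu> {..0} = 0 \<and>
     (\<integral>\<^sup>+v. ennreal (min v (v\<^sup>2)) \<partial>\<mu>) < \<infinity> \<and>
     (\<forall>x\<ge>0. 1/2 * ((Q *v G x) \<bullet> G x) = c * x) \<and>
     (\<forall>x\<ge>0. \<forall>A\<in>sets borel. A \<subseteq> {0<..} \<longrightarrow>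
        emeasure (projected_measure \<nu> (G x)) A =
        emeasure (projected_measure \<nu> (G 0)) A + ennreal x * emeasure \<mu> A)"

definition J_tilde :: "real \<Rightarrow> real measure \<Rightarrow> real \<Rightarrow> real" where
  "J_tilde c \<mu> \<beta> = c * \<beta>\<^sup>2 + (\<integral>v. exp (- \<beta> * v) - 1 + \<beta> * v \<partial>\<mu>)"

text \<open>A generating pair whose function \<open>J_tilde\<close> equals \<open>F\<close> on \<open>[0, \<infinity>)\<close>.\<close>

definition generating_pair_of_form ::
    "'w measure \<Rightarrow> (real \<Rightarrow> 'w \<Rightarrow> real^'n) \<Rightarrow> real^'n^'n \<Rightarrow> (real^'n) measure \<Rightarrow> (real \<Rightarrow> real^'n)
      \<Rightarrow> (real \<Rightarrow> real) \<Rightarrow> bool" where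
  "generating_pair_of_form M Z Q \<nu> G F \<longleftrightarrow>
     (\<exists>c \<mu>. generating_pair_with M Z Q \<nu> G c \<mu> \<and> (\<forall>\<beta>\<ge>0. J_tilde c \<mu> \<beta> = F \<beta>))"

end

theory Submission
  imports Defs
begin

text \<open>
  By the Levy-Khintchine formula and independence, \<open>(G, Z)\<close> is a generating pair of the form \<open>F\<close>
  exactly when \<open>G 0 = 0\<close> and \<open>J1 (\<beta> G1(x)) + J2 (\<beta> G2(x)) = x F(\<beta>)\<close>. For the converse direction, the
  pair \<open>(c, \<mu>)\<close> is read off at \<open>x = 1\<close> and transported to the other \<open>x\<close> by the uniqueness of the
  Levy-Khintchine representation. That \<open>G 0 = 0\<close> uses infinite variation: otherwise some \<open>Ji\<close> grows at
  most linearly and \<open>Zi\<close> is a nondecreasing process minus a drift.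

  If \<open>G2 / G1\<close> takes two values \<open>r < s\<close>, subtracting the two instances of the functional equation
  gives \<open>J2 (s u) - J2 (r u) = A u^a + B u^b\<close>, and iterating \<open>u \<mapsto> (r / s) u\<close> towards \<open>0\<close>
  shows that \<open>J2\<close>, hence also \<open>J1\<close>, is a combination of the two powers. Regular variation at zero and
  the growth of \<open>G\<close> then eliminate the unwanted powers. If \<open>G2 / G1\<close> is constant, the equation is about
  a single process, which is stable.
\<close>

section \<open>Uniqueness of the Levy-Khintchine representation\<close>

text \<open>The hypotheses speak of measures, the classification speaks of Laplace exponents, and
  the link is the Hausdorff moment problem: under w = exp(-v) the values of an exponent at integers
  become moments on [0,1]. Third differences serve twice. They annihilate the quadratic Wiener term,
  and the weight (1 - exp(-v))^3 that they produce turns a possibly infinite jump measure into a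
  finite one. In the functional equation \<beta> is free, so it can normalise the argument of
  \<open>J1\<close>; what is left of \<open>G\<close> on that side is the ratio G2 / G1, hence the
  split according to whether this ratio is constant. With two powers the eliminations take place at
  opposite ends: near zero, regular variation forbids the smaller power in \<open>J1\<close>; at
  infinity, the larger power in \<open>J2\<close> would make the left side outgrow the linear right
  side. The constant c_0 of the proportional case is a normalisation: rescaling the vector of the
  \<gamma>'s changes the coefficient of the stable process, so this coefficient can be fixed as
  \<open>c_stable\<close>.\<close>

lemma integral_eq_of_moments_eq:
  fixes M N :: "real measure" and f :: "real \<Rightarrow> real"
  assumes "finite_measure M" "sets M = sets borel" "AE w in M. w \<in> {0..1}"
    and "finite_measure N" "sets N = sets borel" "AE w in N. w \<in> {0..1}"
    and moments: "\<And>n. (\<integral>w. w ^ n \<partial>M) = (\<integral>w. w ^ n \<partial>N)"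
    and f: "continuous_on UNIV f"
  shows "(\<integral>w. f w \<partial>M) = (\<integral>w. f w \<partial>N)"
proof -
  have f_meas: "f \<in> borel_measurable borel"
    using f by (rule borel_measurable_continuous_onI)
  obtain B where B: "\<And>w. w \<in> {0..1} \<Longrightarrow> \<bar>f w\<bar> \<le> B"
    using compact_imp_bounded[OF compact_continuous_image[OF continuous_on_subset[OF f] compact_Icc]]
    by (fastforce simp: bounded_iff)
  have int_f: "integrable K f" if "finite_measure K" "sets K = sets borel" "AE w in K. w \<in> {0..1}" for K
  proof (rule finite_measure.integrable_const_bound[where B = B])
    show "f \<in> borel_measurable K" using f_meas that(2) by (simp cong: measurable_cong_sets)
    show "AE w in K. norm (f w) \<le> B" using that(3) by eventually_elim (use B in auto)
  qed (use that in auto)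
  have int_pow: "integrable K (\<lambda>w. w ^ n)" if "finite_measure K" "sets K = sets borel" "AE w in K. w \<in> {0..1}"
    for K :: "real measure" and n :: nat
  proof (rule finite_measure.integrable_const_bound[where B = 1])
    show "(\<lambda>w. w ^ n) \<in> borel_measurable K" using that(2) by (simp cong: measurable_cong_sets)
    show "AE w in K. norm (w ^ n) \<le> 1" using that(3) by eventually_elim (auto simp: power_le_one)
  qed (use that in auto)
  have close: "\<bar>(\<integral>w. f w \<partial>K) - (\<integral>w. g w \<partial>K)\<bar> \<le> e * measure K UNIV"
    if K: "finite_measure K" "sets K = sets borel" "AE w in K. w \<in> {0..1}"
      and g: "integrable K g" "\<And>w. w \<in> {0..1} \<Longrightarrow> \<bar>f w - g w\<bar> < e" for K g e
  proof -
    interpret finite_measure K by fact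
    have space: "space K = UNIV" using sets_eq_imp_space_eq[OF K(2)] by simp
    have "\<bar>(\<integral>w. f w \<partial>K) - (\<integral>w. g w \<partial>K)\<bar> = \<bar>\<integral>w. f w - g w \<partial>K\<bar>"
      using int_f[OF K] g(1) by simp
    also have "\<dots> \<le> (\<integral>w. \<bar>f w - g w\<bar> \<partial>K)" by (rule integral_abs_bound)
    also have "\<dots> \<le> (\<integral>w. e \<partial>K)"
    proof (rule integral_mono_AE)
      show "AE w in K. \<bar>f w - g w\<bar> \<le> e"
        using K(3) by eventually_elim (use g(2) in \<open>auto intro: less_imp_le\<close>)
    qed (use int_f[OF K] g(1) in auto)
    finally show ?thesis by (simp add: space mult.commute)
  qed
  define m where "m = measure M UNIV + measure N UNIV"
  have m: "m \<ge> 0" unfolding m_def by simp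
  have "\<bar>(\<integral>w. f w \<partial>M) - (\<integral>w. f w \<partial>N)\<bar> \<le> 0 + d" if "d > 0" for d
  proof -
    \<comment> \<open>The 1 keeps the denominator positive when both masses vanish; the total error
      \<open>e * m\<close> is then at most \<open>d\<close>.\<close>
    define e where "e = d / (m + 1)"
    have "e > 0" using that m by (simp add: e_def)
    \<comment> \<open>Equal moments give equal integrals of polynomials. Uniform approximation
      carries this over to \<open>f\<close>, with an error controlled by the total masses.\<close>
    obtain g where g: "real_polynomial_function g" "\<And>w. w \<in> {0..1} \<Longrightarrow> \<bar>f w - g w\<bar> < e"
      using Stone_Weierstrass_real_polynomial_function[OF compact_Icc continuous_on_subset[OF f] \<open>e > 0\<close>]
      by (metis subset_UNIV)
    obtain a n where a: "g = (\<lambda>w. \<Sum>i\<le>n. a i * w ^ i)"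
      using g(1) real_polynomial_function_iff_sum by blast
    have int_g: "integrable M g" "integrable N g"
      using int_pow assms unfolding a by auto
    have "(\<integral>w. g w \<partial>M) = (\<integral>w. g w \<partial>N)"
      unfolding a using int_pow assms by (simp add: moments)
    then have "\<bar>(\<integral>w. f w \<partial>M) - (\<integral>w. f w \<partial>N)\<bar> \<le> e * m"
      using close[OF assms(1-3) int_g(1) g(2)] close[OF assms(4-6) int_g(2) g(2)]
      unfolding m_def distrib_left by linarith
    also have "\<dots> \<le> d" using that m by (simp add: e_def field_simps)
    finally show ?thesis by simp
  qed
  then have "\<bar>(\<integral>w. f w \<partial>M) - (\<integral>w. f w \<partial>N)\<bar> \<le> 0" by (rule field_le_epsilon)
  then show ?thesis by simp
qed

text \<open>It suffices to compare distribution functions. The indicator of \<open>{..a}\<close> is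
  not continuous, but it is a bounded pointwise limit of continuous functions, and dominated
  convergence applies to finite measures.\<close>

lemma measure_eq_of_moments_eq:
  fixes M N :: "real measure"
  assumes M: "finite_measure M" "sets M = sets borel" "AE w in M. w \<in> {0..1}"
    and N: "finite_measure N" "sets N = sets borel" "AE w in N. w \<in> {0..1}"
    and moments: "\<And>n. (\<integral>w. w ^ n \<partial>M) = (\<integral>w. w ^ n \<partial>N)"
  shows "M = N"
proof (rule cdf_unique')
  show "finite_borel_measure M" "finite_borel_measure N"
    using M N by (auto simp: finite_borel_measure_def finite_borel_measure_axioms_def)
  \<comment> \<open>A ramp that equals 1 up to and including \<open>a\<close> and then falls to 0
    with slope n, so that the limit is the indicator of the closed half-line.\<close>
  define f where "f a n w = max 0 (min 1 (1 - real n * (w - a)))" for a :: real and n :: nat and w :: real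
  have cont: "continuous_on UNIV (f a n)" for a n
    unfolding f_def by (intro continuous_intros)
  have lim: "(\<lambda>n. f a n w) \<longlonglongrightarrow> indicator {..a} w" for a w
  proof (cases "w \<le> a")
    case True
    then have "f a n w = 1" for n
      unfolding f_def by (simp add: mult_nonneg_nonpos)
    then show ?thesis using True by simp
  next
    case False
    obtain k :: nat where k: "1 / (w - a) < real k" using reals_Archimedean2 by blast
    have "f a n w = 0" if "n \<ge> k" for n
    proof -
      have "1 < real k * (w - a)" using k False by (simp add: field_simps)
      also have "\<dots> \<le> real n * (w - a)" using that False by (intro mult_right_mono) auto
      finally show ?thesis by (simp add: f_def)
    qed
    then have "\<forall>\<^sub>F n in sequentially. f a n w = indicator {..a} w"
      using False by (auto simp: eventually_sequentially)
    then show ?thesis by (rule tendsto_eventually)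
  qed
  have cdf_lim: "(\<lambda>n. \<integral>w. f a n w \<partial>K) \<longlonglongrightarrow> cdf K a"
    if K: "finite_measure K" "sets K = sets borel" for K a
  proof -
    have "(\<lambda>n. \<integral>w. f a n w \<partial>K) \<longlonglongrightarrow> (\<integral>w. indicator {..a} w \<partial>K)"
    proof (rule integral_dominated_convergence[where w = "\<lambda>_. 1"])
      show "f a n \<in> borel_measurable K" for n
        using borel_measurable_continuous_onI[OF cont] K(2) by (simp cong: measurable_cong_sets)
      show "(\<lambda>w. indicator {..a} w :: real) \<in> borel_measurable K"
        using K(2) by (simp cong: measurable_cong_sets)
      show "integrable K (\<lambda>_. 1 :: real)" using finite_measure.integrable_const[OF K(1)] .
      show "AE w in K. (\<lambda>n. f a n w) \<longlonglongrightarrow> indicator {..a} w" using lim by simp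
      show "AE w in K. norm (f a n w) \<le> 1" for n by (simp add: f_def)
    qed
    moreover have "(\<integral>w. indicator {..a} w \<partial>K) = cdf K a"
      unfolding cdf_def using sets_eq_imp_space_eq[OF K(2)] by simp
    ultimately show ?thesis by simp
  qed
  show "cdf M = cdf N"
  proof
    fix a
    show "cdf M a = cdf N a"
      using cdf_lim[OF M(1,2), of a] cdf_lim[OF N(1,2), of a]
        integral_eq_of_moments_eq[OF M N moments cont] LIMSEQ_unique by simp
  qed
qed

section \<open>The compensated exponential of the Levy-Khintchine formula\<close>

definition psi :: "real \<Rightarrow> real" where
  "psi s = exp (- s) - 1 + s"

lemma psi_measurable [measurable]: "psi \<in> borel_measurable borel"
  unfolding psi_def by measurable

lemma psi_0 [simp]: "psi 0 = 0"
  by (simp add: psi_def)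

lemma psi_nonneg [simp]: "0 \<le> psi s"
  using exp_ge_add_one_self[of "-s"] by (simp add: psi_def)

text \<open>This matches the integrability condition on jump measures. The quadratic bound comes
  from exp(-s) \<le> 1 / (1 + s), the linear one from exp(-s) \<le> 1.\<close>

lemma psi_le_min:
  assumes "0 \<le> s"
  shows "psi s \<le> min s (s\<^sup>2)"
proof -
  have "1 + s > 0" using assms by simp
  have "exp (-s) \<le> 1 / (1 + s)"
    unfolding exp_minus inverse_eq_divide using assms exp_ge_add_one_self[of s]
    by (intro divide_left_mono) auto
  then have "psi s \<le> 1 / (1 + s) - 1 + s" by (simp add: psi_def)
  also have "\<dots> = s\<^sup>2 / (1 + s)" using \<open>1 + s > 0\<close> by (simp add: field_simps power2_eq_square)
  also have "\<dots> \<le> s\<^sup>2" using \<open>1 + s > 0\<close> assms by (simp add: field_simps)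
  finally show ?thesis using assms by (simp add: psi_def)
qed

text \<open>Convexity of \<open>exp\<close> on the segment from 0 to -s. It later bounds the
  exponents near zero.\<close>

lemma psi_mult_le:
  assumes "0 \<le> l" "l \<le> 1"
  shows "psi (l * s) \<le> l * psi s"
proof -
  have "exp ((1 - l) * 0 + l * (-s)) \<le> (1 - l) * exp 0 + l * exp (-s)"
    using convex_onD[OF exp_convex, of l 0 "-s"] assms by simp
  then show ?thesis by (simp add: psi_def algebra_simps)
qed

lemma min_mult_le:
  fixes k s :: real
  assumes "0 \<le> k" "0 \<le> s"
  shows "min (k * s) ((k * s)\<^sup>2) \<le> max k (k\<^sup>2) * min s (s\<^sup>2)"
proof (cases "s \<le> s\<^sup>2")
  case True
  have "k * s \<le> max k (k\<^sup>2) * s" using assms by (intro mult_right_mono) auto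
  then show ?thesis using True by simp
next
  case False
  have "k\<^sup>2 * s\<^sup>2 \<le> max k (k\<^sup>2) * s\<^sup>2" using assms by (intro mult_right_mono) auto
  then show ?thesis using False by (simp add: power_mult_distrib)
qed

lemma J_tilde_eq_psi: "J_tilde c \<mu> \<beta> = c * \<beta>\<^sup>2 + (\<integral>v. psi (\<beta> * v) \<partial>\<mu>)"
  by (simp add: J_tilde_def psi_def)

text \<open>The third difference of \<open>n \<mapsto> c n\<^sup>2 + \<integral> psi (n v) \<mu>(dv)\<close> no longer contains \<open>c\<close>, and is
  the \<open>n\<close>-th moment of the image of the finite measure \<open>(1 - exp (-v)) ^ 3 \<mu>(dv)\<close> under
  \<open>v \<mapsto> exp (-v)\<close>.\<close>

lemma psi_third_difference:
  "psi (n * v) - 3 * psi ((n + 1) * v) + 3 * psi ((n + 2) * v) - psi ((n + 3) * v)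
    = (1 - exp (-v)) ^ 3 * exp (- v) powr n"
proof -
  have "exp (- ((n + real k) * v)) = exp (- (n * v)) * exp (-v) ^ k" for k :: nat
    by (simp add: exp_of_nat_mult[symmetric] exp_add[symmetric] algebra_simps)
  from this[of 1] this[of 2] this[of 3]
  show ?thesis
    by (simp add: psi_def powr_def algebra_simps power3_eq_cube power2_eq_square)
qed

section \<open>Recovering a jump measure from its exponent\<close>

locale levy_measure_on_Ioi =
  fixes \<mu> :: "real measure"
  assumes sets_\<mu>: "sets \<mu> = sets borel"
    and null_Iic: "emeasure \<mu> {..0} = 0"
    and finite_min: "(\<integral>\<^sup>+v. ennreal (min v (v\<^sup>2)) \<partial>\<mu>) < \<infinity>"
begin

lemma measurable_\<mu> [measurable_cong]: "sets \<mu> = sets borel"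
  by (rule sets_\<mu>)

lemma space_\<mu> [simp]: "space \<mu> = UNIV"
  using sets_eq_imp_space_eq[OF sets_\<mu>] by simp

lemma AE_pos: "AE v in \<mu>. 0 < v"
  by (rule AE_I[where N = "{..0}"]) (use null_Iic in \<open>auto simp: sets_\<mu>\<close>)

lemma integrable_min: "integrable \<mu> (\<lambda>v. min v (v\<^sup>2))"
  using finite_min AE_pos by (intro integrableI_nonneg) (auto elim!: eventually_mono)

lemma integrable_psi:
  assumes "0 \<le> \<beta>"
  shows "integrable \<mu> (\<lambda>v. psi (\<beta> * v))"
proof (rule Bochner_Integration.integrable_bound)
  show "integrable \<mu> (\<lambda>v. max \<beta> (\<beta>\<^sup>2) * min v (v\<^sup>2))" using integrable_min by simp
  show "AE v in \<mu>. norm (psi (\<beta> * v)) \<le> norm (max \<beta> (\<beta>\<^sup>2) * min v (v\<^sup>2))"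
    using AE_pos
  proof eventually_elim
    case (elim v)
    have "psi (\<beta> * v) \<le> max \<beta> (\<beta>\<^sup>2) * min v (v\<^sup>2)"
      using order_trans[OF psi_le_min min_mult_le] assms elim by simp
    then show ?case by (simp add: abs_of_nonneg)
  qed
qed simp

text \<open>On the positive half-line the weight lies below min(v, v^2), which makes the measure
  finite, and it is positive, which makes the weighting invertible.\<close>

definition weighted :: "real measure" where
  "weighted = density \<mu> (\<lambda>v. ennreal ((1 - exp (-v)) ^ 3))"

lemma weight_integrable: "integrable \<mu> (\<lambda>v. (1 - exp (-v)) ^ 3)"
proof (rule Bochner_Integration.integrable_bound[OF integrable_min])
  show "AE v in \<mu>. norm ((1 - exp (-v)) ^ 3) \<le> norm (min v (v\<^sup>2))"
    using AE_pos
  proof eventually_elim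
    case (elim v)
    have w: "0 \<le> 1 - exp (-v)" "1 - exp (-v) \<le> 1" "1 - exp (-v) \<le> v"
      using elim exp_ge_add_one_self[of "-v"] by auto
    have "(1 - exp (-v)) ^ 3 \<le> (1 - exp (-v))\<^sup>2" using w by (intro power_decreasing) auto
    also have "\<dots> \<le> v\<^sup>2" using w by (intro power_mono) auto
    finally have "(1 - exp (-v)) ^ 3 \<le> v\<^sup>2" .
    moreover have "(1 - exp (-v)) ^ 3 \<le> (1 - exp (-v)) ^ 1" using w by (intro power_decreasing) auto
    ultimately show ?case using w elim by simp
  qed
qed simp

lemma weight_nonneg: "AE v in \<mu>. 0 \<le> (1 - exp (-v)) ^ 3"
  using AE_pos by eventually_elim auto

lemma finite_weighted: "finite_measure weighted"
proof (rule finite_measureI)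
  have "emeasure weighted (space weighted) = ennreal (\<integral>v. (1 - exp (-v)) ^ 3 \<partial>\<mu>)"
    unfolding weighted_def using weight_integrable weight_nonneg
    by (simp add: emeasure_density nn_integral_eq_integral)
  then show "emeasure weighted (space weighted) \<noteq> \<infinity>" by simp
qed

lemma sets_weighted [measurable_cong]: "sets weighted = sets borel"
  by (simp add: weighted_def sets_\<mu>)

lemma \<mu>_eq_density_weighted:
  "\<mu> = density weighted (\<lambda>v. ennreal (1 / (1 - exp (-v)) ^ 3))"
proof -
  have "density weighted (\<lambda>v. ennreal (1 / (1 - exp (-v)) ^ 3)) = density \<mu> (\<lambda>_. 1)"
    unfolding weighted_def
  proof (subst density_density_eq)
    show "density \<mu> (\<lambda>v. ennreal ((1 - exp (-v)) ^ 3) * ennreal (1 / (1 - exp (-v)) ^ 3)) = density \<mu> (\<lambda>_. 1)"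
    proof (rule density_cong)
      show "AE v in \<mu>. ennreal ((1 - exp (-v)) ^ 3) * ennreal (1 / (1 - exp (-v)) ^ 3) = 1"
        using AE_pos
      proof eventually_elim
        case (elim v)
        have "(1 - exp (-v)) ^ 3 > 0" using elim by (intro zero_less_power) simp
        then show ?case by (simp add: ennreal_mult[symmetric])
      qed
    qed measurable
  qed measurable
  then show ?thesis by (simp add: density_1)
qed

text \<open>The substitution w = exp(-v), which moves the measure into [0,1], loses nothing because
  -ln inverts it.\<close>

lemma weighted_eq_distr: "weighted = distr (distr weighted borel (\<lambda>v. exp (-v))) borel (\<lambda>w. - ln w)"
proof -
  have "distr (distr weighted borel (\<lambda>v. exp (-v))) borel (\<lambda>w. - ln w) = distr weighted weighted (\<lambda>v. v)"
    by (subst distr_distr; (unfold comp_def)?; (rule distr_cong)?; simp add: sets_weighted)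
  also have "\<dots> = weighted" by (rule distr_id)
  finally show ?thesis ..
qed

lemma moment_weighted:
  "(\<integral>w. w ^ n \<partial>distr weighted borel (\<lambda>v. exp (-v))) =
    J_tilde c \<mu> (real n) - 3 * J_tilde c \<mu> (real (n + 1)) + 3 * J_tilde c \<mu> (real (n + 2))
      - J_tilde c \<mu> (real (n + 3))"
proof -
  have "(\<integral>w. w ^ n \<partial>distr weighted borel (\<lambda>v. exp (-v))) = (\<integral>v. (1 - exp (-v)) ^ 3 * exp (-v) ^ n \<partial>\<mu>)"
    unfolding weighted_def
    by (subst integral_distr, simp, simp, subst integral_density) (use weight_nonneg in simp_all)
  also have "\<dots> = (\<integral>v. psi (real n * v) - 3 * psi ((real n + 1) * v) + 3 * psi ((real n + 2) * v)
      - psi ((real n + 3) * v) \<partial>\<mu>)"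
    by (subst psi_third_difference) (simp add: powr_realpow)
  also have "\<dots> = (\<integral>v. psi (real n * v) \<partial>\<mu>) - 3 * (\<integral>v. psi ((real n + 1) * v) \<partial>\<mu>)
      + 3 * (\<integral>v. psi ((real n + 2) * v) \<partial>\<mu>) - (\<integral>v. psi ((real n + 3) * v) \<partial>\<mu>)"
    using integrable_psi[of "real n"] integrable_psi[of "real n + 1"] integrable_psi[of "real n + 2"]
      integrable_psi[of "real n + 3"] by simp
  also have "\<dots> = J_tilde c \<mu> (real n) - 3 * J_tilde c \<mu> (real (n + 1))
      + 3 * J_tilde c \<mu> (real (n + 2)) - J_tilde c \<mu> (real (n + 3))"
    by (simp add: J_tilde_eq_psi algebra_simps power2_eq_square)
  finally show ?thesis .
qed

lemma AE_distr_weighted: "AE w in distr weighted borel (\<lambda>v. exp (-v)). w \<in> {0..1}"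
  unfolding weighted_def using AE_pos
  by (subst AE_distr_iff) (auto simp: AE_density elim!: eventually_mono)

end

text \<open>Integer arguments suffice because they supply all moments of the weighted measures. The
  jump measures are thus identified before the Wiener coefficients, which are then compared at n =
  1.\<close>

lemma J_tilde_unique:
  assumes "levy_measure_on_Ioi \<mu>" "levy_measure_on_Ioi \<mu>'"
    and eq: "\<And>n::nat. J_tilde c \<mu> (real n) = J_tilde c' \<mu>' (real n)"
  shows "c = c' \<and> \<mu> = \<mu>'"
proof -
  interpret L: levy_measure_on_Ioi \<mu> by fact
  interpret R: levy_measure_on_Ioi \<mu>' by fact
  have "(\<integral>w. w ^ n \<partial>distr L.weighted borel (\<lambda>v. exp (-v)))
    = (\<integral>w. w ^ n \<partial>distr R.weighted borel (\<lambda>v. exp (-v)))" for n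
    unfolding L.moment_weighted[where c = c] R.moment_weighted[where c = c'] eq ..
  then have "distr L.weighted borel (\<lambda>v. exp (-v)) = distr R.weighted borel (\<lambda>v. exp (-v))"
    by (intro measure_eq_of_moments_eq finite_measure.finite_measure_distr L.finite_weighted
        R.finite_weighted L.AE_distr_weighted R.AE_distr_weighted)
      simp_all
  then have "L.weighted = R.weighted"
    using L.weighted_eq_distr R.weighted_eq_distr by simp
  then have "\<mu> = \<mu>'"
    using L.\<mu>_eq_density_weighted R.\<mu>_eq_density_weighted by simp
  then show ?thesis using eq[of 1] by (simp add: J_tilde_eq_psi)
qed

lemma J_tilde_scale:
  assumes "sets \<mu> = sets borel" "0 \<le> x"
  shows "J_tilde (x * c) (scale_measure (ennreal x) \<mu>) \<beta> = x * J_tilde c \<mu> \<beta>"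
proof -
  have [measurable_cong]: "sets \<mu> = sets borel" by fact
  have "(\<integral>v. psi (\<beta> * v) \<partial>scale_measure (ennreal x) \<mu>) = x * (\<integral>v. psi (\<beta> * v) \<partial>\<mu>)"
    using assms(2) by (simp add: integral_eq_nn_integral nn_integral_scale_measure enn2real_mult)
  then show ?thesis by (simp add: J_tilde_eq_psi algebra_simps)
qed

section \<open>The functional equation\<close>

lemma powr_sum_of_difference:
  fixes f :: "real \<Rightarrow> real"
  assumes f0: "(f \<longlongrightarrow> 0) (at_right 0)" and rs: "0 < r" "r < s" and ab: "0 < a" "0 < b"
    and eq: "\<And>u. 0 < u \<Longrightarrow> f (s * u) - f (r * u) = A * u powr a + B * u powr b"
    and v: "0 < v"
  shows "f v = A / (s powr a - r powr a) * v powr a + B / (s powr b - r powr b) * v powr b"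
proof -
  \<comment> \<open>These multiples of the two powers solve the same difference equation as
    \<open>f\<close>; the remainder \<open>D\<close> solves the homogeneous one and is therefore
    invariant under multiplication by \<open>q\<close>.\<close>
  define c where "c = A / (s powr a - r powr a)"
  define d where "d = B / (s powr b - r powr b)"
  define D where "D v = f v - c * v powr a - d * v powr b" for v
  define q where "q = r / s"
  have q: "0 < q" "q < 1" using rs by (auto simp: q_def)
  have "s powr a - r powr a > 0" "s powr b - r powr b > 0"
    using rs ab by (auto intro: powr_less_mono2)
  then have AB: "A = c * (s powr a - r powr a)" "B = d * (s powr b - r powr b)"
    by (auto simp: c_def d_def)
  have D_scale: "D (v * q) = D v" if "v > 0" for v
  proof -
    have u: "v / s > 0" "s * (v / s) = v" "r * (v / s) = v * q"
      using that rs by (auto simp: q_def)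
    have "v powr p = s powr p * (v / s) powr p" "(v * q) powr p = r powr p * (v / s) powr p" for p
      using u rs by (auto simp flip: powr_mult)
    then show ?thesis using eq[OF u(1)] unfolding u AB D_def by (simp add: algebra_simps)
  qed
  have const: "D (v * q ^ n) = D v" for n
  proof (induction n)
    case (Suc n)
    then show ?case using D_scale[of "v * q ^ n"] v q by (simp add: ac_simps)
  qed simp
  have "filterlim (\<lambda>n. v * q ^ n) (at_right 0) sequentially"
    unfolding filterlim_at
  proof
    show "\<forall>\<^sub>F n in sequentially. v * q ^ n \<in> {0<..} \<and> v * q ^ n \<noteq> 0"
      using v q by auto
    show "(\<lambda>n. v * q ^ n) \<longlonglongrightarrow> 0"
      using tendsto_mult_left[OF LIMSEQ_power_zero[of q], of v] q by simp
  qed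
  moreover have "(D \<longlongrightarrow> 0) (at_right 0)"
  proof -
    have "((\<lambda>x::real. x powr p) \<longlongrightarrow> 0) (at_right 0)" if "p > 0" for p
    proof -
      have "((\<lambda>x::real. x powr p) \<longlongrightarrow> 0 powr p) (at_right 0)"
        using that by (intro tendsto_powr' tendsto_intros) (auto simp: eventually_at_filter)
      then show ?thesis by simp
    qed
    from tendsto_diff[OF tendsto_diff[OF f0 tendsto_mult_left[OF this[OF ab(1)], of c]]
        tendsto_mult_left[OF this[OF ab(2)], of d]]
    show ?thesis unfolding D_def[abs_def] by simp
  qed
  ultimately have "(\<lambda>n. D (v * q ^ n)) \<longlonglongrightarrow> 0" by (rule filterlim_compose[rotated])
  then have "D v = 0" unfolding const by (simp add: LIMSEQ_const_iff)
  then show ?thesis by (simp add: D_def c_def d_def)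
qed

text \<open>Distinct powers are linearly independent; the arguments 1 and 2 already separate
  them.\<close>

lemma powr_sum_eq_zero:
  fixes a b P R :: real
  assumes "a \<noteq> b" and eq: "\<And>u. 0 < u \<Longrightarrow> P * u powr a + R * u powr b = 0"
  shows "P = 0" "R = 0"
proof -
  have "R = - P" using eq[of 1] by simp
  then have "P * (2 powr a - 2 powr b) = 0" using eq[of 2] by (simp add: algebra_simps)
  moreover have "(2::real) powr a \<noteq> 2 powr b" using assms(1) by (simp add: powr_inj)
  ultimately show "P = 0" "R = 0" using \<open>R = - P\<close> by auto
qed

lemma powr_sum_coeffs_eq:
  fixes a b p r p' r' :: real
  assumes "a \<noteq> b" "\<And>u. 0 < u \<Longrightarrow> p * u powr a + r * u powr b = p' * u powr a + r' * u powr b"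
  shows "p = p'" "r = r'"
proof -
  have "(p - p') * u powr a + (r - r') * u powr b = 0" if "0 < u" for u
    using assms(2)[OF that] by (simp add: algebra_simps)
  from powr_sum_eq_zero[OF assms(1) this] show "p = p'" "r = r'" by simp_all
qed

text \<open>The analytic content of the generating-pair condition. A single power is the case a = b
  with \<open>\<eta>2 = 0\<close>. The limit at zero is stated for \<open>J2\<close>, because
  \<open>J1\<close> is read off from the equation once \<open>J2\<close> is known.\<close>

locale exponent_equation =
  fixes J1 J2 g1 g2 :: "real \<Rightarrow> real" and \<eta>1 \<eta>2 a b :: real
  assumes g_pos: "\<And>x. 0 < x \<Longrightarrow> 0 < g1 x" "\<And>x. 0 < x \<Longrightarrow> 0 < g2 x"
    and ab: "0 < a" "0 < b"
    and J_lim: "(J2 \<longlongrightarrow> 0) (at_right 0)"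
    and J_nonneg: "\<And>u. 0 < u \<Longrightarrow> 0 \<le> J1 u" "\<And>u. 0 < u \<Longrightarrow> 0 \<le> J2 u"
    and equation: "\<And>x \<beta>. 0 < x \<Longrightarrow> 0 < \<beta> \<Longrightarrow>
      J1 (\<beta> * g1 x) + J2 (\<beta> * g2 x) = x * (\<eta>1 * \<beta> powr a + \<eta>2 * \<beta> powr b)"
begin

text \<open>The choice \<beta> = u / g1 x frees the argument of \<open>J1\<close> from x, so that
  \<open>J1\<close> cancels between two instances of the equation.\<close>

lemma equation_ratio:
  assumes "0 < x" "0 < u"
  shows "J1 u + J2 (g2 x / g1 x * u)
    = x * \<eta>1 / g1 x powr a * u powr a + x * \<eta>2 / g1 x powr b * u powr b"
proof -
  have "J1 (u / g1 x * g1 x) + J2 (u / g1 x * g2 x)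
    = x * (\<eta>1 * (u / g1 x) powr a + \<eta>2 * (u / g1 x) powr b)"
    using assms g_pos by (intro equation) auto
  moreover have "(u / g1 x) powr p = u powr p / g1 x powr p" for p
    using assms g_pos[OF assms(1)] by (simp add: powr_divide)
  moreover have "u / g1 x * g1 x = u" using g_pos(1)[OF assms(1)] by simp
  moreover have "u / g1 x * g2 x = g2 x / g1 x * u" by simp
  ultimately show ?thesis by (simp add: algebra_simps)
qed

lemma exponents_powr_sum:
  assumes nonconst: "\<not> (\<exists>r. \<forall>x>0. g2 x = r * g1 x)"
  obtains c1 d1 c2 d2 where "\<And>u. 0 < u \<Longrightarrow> J1 u = c1 * u powr a + d1 * u powr b"
    "\<And>u. 0 < u \<Longrightarrow> J2 u = c2 * u powr a + d2 * u powr b"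
proof -
  have "\<exists>x>0. \<exists>y>0. g2 x / g1 x < g2 y / g1 y"
  proof (rule ccontr)
    assume "\<not> ?thesis"
    then have "g2 x / g1 x = g2 1 / g1 1" if "0 < x" for x
      using that by (metis linorder_neqE_linordered_idom zero_less_one)
    then have "g2 x = g2 1 / g1 1 * g1 x" if "0 < x" for x
      using that g_pos(1)[OF that] by (metis nonzero_eq_divide_eq less_irrefl)
    then show False using nonconst by blast
  qed
  then obtain x y where xy: "0 < x" "0 < y" "g2 x / g1 x < g2 y / g1 y" by blast
  define r s where "r = g2 x / g1 x" and "s = g2 y / g1 y"
  \<comment> \<open>The coefficients of the difference of the instances at \<open>y\<close> and at
    \<open>x\<close>.\<close>
  define A where "A = y * \<eta>1 / g1 y powr a - x * \<eta>1 / g1 x powr a"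
  define B where "B = y * \<eta>2 / g1 y powr b - x * \<eta>2 / g1 x powr b"
  define c2 where "c2 = A / (s powr a - r powr a)"
  define d2 where "d2 = B / (s powr b - r powr b)"
  have rs: "0 < r" "r < s" using xy g_pos by (auto simp: r_def s_def)
  have "J2 (s * u) - J2 (r * u) = A * u powr a + B * u powr b" if "0 < u" for u
    using equation_ratio[OF xy(1) that] equation_ratio[OF xy(2) that]
    by (simp add: A_def B_def r_def s_def algebra_simps)
  from powr_sum_of_difference[OF J_lim rs ab this]
  have J2: "J2 v = c2 * v powr a + d2 * v powr b" if "0 < v" for v
    using that unfolding c2_def d2_def by blast
  have J1: "J1 u = (x * \<eta>1 / g1 x powr a - c2 * r powr a) * u powr a
      + (x * \<eta>2 / g1 x powr b - d2 * r powr b) * u powr b" if "0 < u" for u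
    using equation_ratio[OF xy(1) that] J2[of "r * u"] rs that
    by (simp add: r_def[symmetric] powr_mult algebra_simps)
  show thesis using J1 J2 that by blast
qed

end

section \<open>Selection of the powers by regular variation and growth\<close>

lemma regularly_varying_pos:
  assumes "regularly_varying_at_0 J a" "\<And>u. 0 < u \<Longrightarrow> 0 \<le> J u"
  obtains u where "0 < u" "0 < J u"
proof -
  have "((\<lambda>x. J (1 * x) / J x) \<longlongrightarrow> 1 powr a) (at_right 0)"
    using assms(1) unfolding regularly_varying_at_0_def by (meson zero_less_one)
  \<comment> \<open>The quotient is 0 wherever \<open>J x = 0\<close>, by the convention for
    division, so the limit 1 forces nonzero values.\<close>
  then have "((\<lambda>x. J x / J x) \<longlongrightarrow> 1) (at_right 0)" by simp
  then have "\<forall>\<^sub>F x in at_right 0. 0 < J x / J x"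
    by (rule order_tendstoD) simp
  then have "\<forall>\<^sub>F x in at_right 0. 0 < x \<and> 0 < J x / J x"
    using eventually_at_right_less by (rule eventually_conj[rotated])
  then obtain x where "0 < x" "0 < J x / J x"
    using eventually_happens'[OF trivial_limit_at_right_real] by blast
  moreover have "J x \<noteq> 0" using calculation by auto
  ultimately show thesis using that assms(2)[of x] by fastforce
qed

text \<open>The smaller power dominates at zero.\<close>

lemma regularly_varying_powr_sum:
  assumes "regularly_varying_at_0 J a" "b < a"
    and J: "\<And>u. 0 < u \<Longrightarrow> J u = c * u powr a + d * u powr b"
  shows "d = 0"
proof (rule ccontr)
  assume d: "d \<noteq> 0"
  have lim: "((\<lambda>x. x powr (a - b)) \<longlongrightarrow> 0) (at_right (0::real))"
  proof -
    have "((\<lambda>x::real. x powr (a - b)) \<longlongrightarrow> 0 powr (a - b)) (at_right 0)"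
      using assms(2) by (intro tendsto_powr' tendsto_intros) (auto simp: eventually_at_filter)
    then show ?thesis by simp
  qed
  \<comment> \<open>This is \<open>J (2 * x) / J x\<close> after cancelling \<open>x powr b\<close>;
    the ratio 2 is enough to tell the index \<open>b\<close> from \<open>a\<close>.\<close>
  have "((\<lambda>x. (c * 2 powr a * x powr (a - b) + d * 2 powr b) / (c * x powr (a - b) + d))
      \<longlongrightarrow> (c * 2 powr a * 0 + d * 2 powr b) / (c * 0 + d)) (at_right 0)"
    using d by (intro tendsto_intros lim) auto
  moreover have "\<forall>\<^sub>F x in at_right 0. (c * 2 powr a * x powr (a - b) + d * 2 powr b) / (c * x powr (a - b) + d)
      = J (2 * x) / J x"
    using eventually_at_right_less[of "0::real"]
  proof eventually_elim
    case (elim x)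
    have e: "x powr a = x powr (a - b) * x powr b" by (simp flip: powr_add)
    have "J (2 * x) = (c * 2 powr a * x powr (a - b) + d * 2 powr b) * x powr b"
      using elim by (subst J) (simp_all add: powr_mult e algebra_simps)
    moreover have "J x = (c * x powr (a - b) + d) * x powr b"
      using elim by (subst J) (simp_all add: e algebra_simps)
    ultimately show ?case using elim by simp
  qed
  ultimately have "((\<lambda>x. J (2 * x) / J x) \<longlongrightarrow> 2 powr b) (at_right 0)"
    using d by (simp add: tendsto_cong)
  moreover have "((\<lambda>x. J (2 * x) / J x) \<longlongrightarrow> 2 powr a) (at_right 0)"
    using assms(1) unfolding regularly_varying_at_0_def by simp
  ultimately have "(2::real) powr b = 2 powr a"
    using tendsto_unique[OF trivial_limit_at_right_real] by blast
  then show False using assms(2) by (simp add: powr_inj)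
qed

text \<open>With equal powers the two coefficients of each exponent merge into one. Regular
  variation makes it positive, since it implies that the exponent is positive somewhere.\<close>

lemma (in exponent_equation) one_power_cases:
  assumes "a = b" "\<eta>2 = 0" "regularly_varying_at_0 J1 a1" "regularly_varying_at_0 J2 a2"
  shows "(\<exists>r>0. \<forall>x>0. g2 x = r * g1 x) \<or>
    (\<exists>c1>0. \<exists>c2>0. \<forall>u>0. J1 u = c1 * u powr a \<and> J2 u = c2 * u powr a)"
proof (cases "\<exists>r. \<forall>x>0. g2 x = r * g1 x")
  case True
  then obtain r where r: "\<forall>x>0. g2 x = r * g1 x" by blast
  then have "r > 0" using g_pos[of 1] by (simp add: zero_less_mult_iff)
  then show ?thesis using r by blast
next
  case False
  obtain c1 d1 c2 d2 where c: "\<And>u. 0 < u \<Longrightarrow> J1 u = c1 * u powr a + d1 * u powr b"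
    "\<And>u. 0 < u \<Longrightarrow> J2 u = c2 * u powr a + d2 * u powr b"
    using exponents_powr_sum[OF False] by blast
  then have J: "\<forall>u>0. J1 u = (c1 + d1) * u powr a \<and> J2 u = (c2 + d2) * u powr a"
    using assms(1) by (simp add: algebra_simps)
  obtain u where "0 < u" "0 < J1 u" using regularly_varying_pos[OF assms(3) J_nonneg(1)] .
  then have "0 < c1 + d1" using J by (simp add: zero_less_mult_iff)
  obtain v where "0 < v" "0 < J2 v" using regularly_varying_pos[OF assms(4) J_nonneg(2)] .
  then have "0 < c2 + d2" using J by (simp add: zero_less_mult_iff)
  show ?thesis using J \<open>0 < c1 + d1\<close> \<open>0 < c2 + d2\<close> by blast
qed

text \<open>A constant ratio is impossible: passing from x = 1 to x = 2 would multiply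
  \<open>g1\<close> by both 2^(1/a) and 2^(1/b). Comparing the powers of \<beta> then gives one
  identity for each power. The identity for \<open>b\<close> determines \<open>g2\<close>, and with
  this knowledge the identity for \<open>a\<close> rules out \<open>c2\<close>.\<close>

lemma (in exponent_equation) two_powers:
  assumes \<eta>: "0 < \<eta>1" "0 < \<eta>2" and "b < a" and rv: "regularly_varying_at_0 J1 a"
  obtains c1 d2 where "0 < c1" "0 < d2"
    "\<And>u. 0 < u \<Longrightarrow> J1 u = c1 * u powr a" "\<And>u. 0 < u \<Longrightarrow> J2 u = d2 * u powr b"
    "\<And>x. 0 < x \<Longrightarrow> g1 x = (\<eta>1 / c1 * x) powr (1 / a)"
    "\<And>x. 0 < x \<Longrightarrow> g2 x = (\<eta>2 / d2 * x) powr (1 / b)"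
proof -
  have root: "g = y powr (1 / p)" if "0 < g" "0 < p" "g powr p = y" for g p y :: real
    using that by (auto simp: powr_powr)
  have "\<not> (\<exists>r. \<forall>x>0. g2 x = r * g1 x)"
  proof
    assume "\<exists>r. \<forall>x>0. g2 x = r * g1 x"
    then obtain r where r: "\<And>x. 0 < x \<Longrightarrow> g2 x = r * g1 x" by blast
    have "g2 2 / g1 2 = g2 1 / g1 1" using r[of 1] r[of 2] g_pos(1)[of 1] g_pos(1)[of 2] by simp
    then have "2 * \<eta>1 / g1 2 powr a * u powr a + 2 * \<eta>2 / g1 2 powr b * u powr b
      = 1 * \<eta>1 / g1 1 powr a * u powr a + 1 * \<eta>2 / g1 1 powr b * u powr b" if "0 < u" for u
      using equation_ratio[of 1 u] equation_ratio[of 2 u] that by simp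
    then have "2 * \<eta>1 / g1 2 powr a = 1 * \<eta>1 / g1 1 powr a" "2 * \<eta>2 / g1 2 powr b = 1 * \<eta>2 / g1 1 powr b"
      using powr_sum_coeffs_eq[of a b] \<open>b < a\<close> by blast+
    then have "(g1 2 / g1 1) powr a = 2" "(g1 2 / g1 1) powr b = 2"
      using g_pos(1)[of 1] g_pos(1)[of 2] \<eta> by (simp_all add: powr_divide field_simps)
    moreover have "0 < g1 2 / g1 1" using g_pos(1)[of 1] g_pos(1)[of 2] by simp
    ultimately have "g1 2 / g1 1 = 2 powr (1 / a)" "g1 2 / g1 1 = 2 powr (1 / b)"
      using root ab by blast+
    then have "1 / a = 1 / b" by (simp add: powr_inj)
    then show False using \<open>b < a\<close> ab by simp
  qed
  then obtain c1 d1 c2 d2 where J1: "\<And>u. 0 < u \<Longrightarrow> J1 u = c1 * u powr a + d1 * u powr b"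
    and J2: "\<And>u. 0 < u \<Longrightarrow> J2 u = c2 * u powr a + d2 * u powr b"
    using exponents_powr_sum by blast
  have "d1 = 0" using regularly_varying_powr_sum[OF rv \<open>b < a\<close> J1] .
  have coeffs: "c1 * g1 x powr a + c2 * g2 x powr a = x * \<eta>1 \<and> d2 * g2 x powr b = x * \<eta>2" if x: "0 < x" for x
  proof -
    have "(c1 * g1 x powr a + c2 * g2 x powr a) * u powr a + (d2 * g2 x powr b) * u powr b
      = x * \<eta>1 * u powr a + x * \<eta>2 * u powr b" if "0 < u" for u
      using equation[OF x that] J1[of "u * g1 x"] J2[of "u * g2 x"] g_pos[OF x] that \<open>d1 = 0\<close>
      by (simp add: powr_mult algebra_simps)
    then show ?thesis using powr_sum_coeffs_eq[of a b] \<open>b < a\<close> by blast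
  qed
  have "0 < d2" using coeffs[of 1] \<eta> g_pos(2)[of 1] by (metis mult_1 zero_less_mult_pos2 zero_less_one powr_gt_zero less_irrefl)
  have g2: "g2 x = (\<eta>2 / d2 * x) powr (1 / b)" if "0 < x" for x
    using coeffs[OF that] \<open>0 < d2\<close> g_pos(2)[OF that] ab by (intro root) (auto simp: field_simps)
  \<comment> \<open>As u tends to infinity, \<open>J2 u / u powr a\<close> tends to
    \<open>c2\<close>, and \<open>J2\<close> is nonnegative.\<close>
  have "0 \<le> c2"
  proof (rule tendsto_lowerbound)
    have "((\<lambda>u. u powr (b - a)) \<longlongrightarrow> 0) (at_top :: real filter)"
      using \<open>b < a\<close> by (intro tendsto_neg_powr filterlim_ident) simp
    from tendsto_add[OF tendsto_const tendsto_mult_left[OF this, of d2], of c2]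
    show "((\<lambda>u. c2 + d2 * u powr (b - a)) \<longlongrightarrow> c2) at_top" by simp
    show "\<forall>\<^sub>F u in at_top. 0 \<le> c2 + d2 * u powr (b - a)"
      using eventually_gt_at_top[of "0::real"]
    proof eventually_elim
      case (elim u)
      have "u powr b = u powr (b - a) * u powr a" by (simp flip: powr_add)
      then have "0 \<le> (c2 + d2 * u powr (b - a)) * u powr a"
        using J2[OF elim] J_nonneg(2)[OF elim] by (simp add: algebra_simps)
      then show ?case using elim by (simp add: zero_le_mult_iff)
    qed
  qed simp
  have "0 < c1"
  proof -
    obtain u where "0 < u" "0 < J1 u" using regularly_varying_pos[OF rv J_nonneg(1)] .
    then show ?thesis using J1 \<open>d1 = 0\<close> by (simp add: zero_less_mult_iff)
  qed
  have "c2 = 0"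
  proof (rule ccontr)
    assume "c2 \<noteq> 0"
    then have "0 < c2" using \<open>0 \<le> c2\<close> by simp
    \<comment> \<open>By the formula for \<open>g2\<close>, the summand
      \<open>c2 * g2 x powr a\<close> equals \<open>K * x powr (a / b)\<close>, while the identity
      for the power \<open>a\<close> bounds it by \<open>x * \<eta>1\<close>.\<close>
    define K where "K = c2 * (\<eta>2 / d2) powr (a / b)"
    have "0 < K" using \<open>0 < c2\<close> \<open>0 < d2\<close> \<eta> by (simp add: K_def)
    have bound: "K * x powr (a / b - 1) \<le> \<eta>1" if "0 < x" for x
    proof -
      have "g2 x powr a = (\<eta>2 / d2) powr (a / b) * x powr (a / b)"
        using that \<eta> \<open>0 < d2\<close> by (simp add: g2 powr_powr flip: powr_mult)
      moreover have "0 \<le> c1 * g1 x powr a" using \<open>0 < c1\<close> by simp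
      ultimately have "K * x powr (a / b) \<le> x * \<eta>1" using coeffs[OF that] by (simp add: K_def)
      moreover have "x powr (a / b) = x * x powr (a / b - 1)"
        using that by (simp add: powr_diff)
      ultimately show ?thesis using that by simp
    qed
    have "0 < a / b - 1" using \<open>b < a\<close> ab by simp
    \<comment> \<open>Chosen so that the left side of \<open>bound\<close> becomes
      \<open>\<eta>1 + 1\<close>.\<close>
    define x where "x = ((\<eta>1 + 1) / K) powr (1 / (a / b - 1))"
    have "x powr (a / b - 1) = (\<eta>1 + 1) / K"
    proof -
      have "1 / (a / b - 1) * (a / b - 1) = 1" using \<open>0 < a / b - 1\<close> by (metis less_irrefl nonzero_eq_divide_eq)
      then show ?thesis unfolding x_def powr_powr using \<open>0 < K\<close> \<eta> by simp
    qed
    moreover have "0 < x" using \<open>0 < K\<close> \<eta> by (simp add: x_def)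
    ultimately show False using bound[of x] \<open>0 < K\<close> by simp
  qed
  have g1: "g1 x = (\<eta>1 / c1 * x) powr (1 / a)" if "0 < x" for x
    using coeffs[OF that] \<open>0 < c1\<close> \<open>c2 = 0\<close> g_pos(1)[OF that] ab by (intro root) (auto simp: field_simps)
  show thesis
    using that[OF \<open>0 < c1\<close> \<open>0 < d2\<close> _ _ g1 g2] J1 J2 \<open>d1 = 0\<close> \<open>c2 = 0\<close> by simp
qed

section \<open>Levy processes\<close>

text \<open>\<open>Lim\<close> commutes with the inner product where the left limit exists, and this
  existence is what the cadlag property supplies. At t \<le> 0 both jumps are 0 by
  definition.\<close>

lemma jump_inner:
  fixes f :: "real \<Rightarrow> 'b::euclidean_space"
  assumes "cadlag f"
  shows "jump (\<lambda>t. a \<bullet> f t) t = a \<bullet> jump f t"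
proof (cases "t > 0")
  case True
  then obtain l where l: "(f \<longlongrightarrow> l) (at_left t)" using assms unfolding cadlag_def by blast
  then have "((\<lambda>t. a \<bullet> f t) \<longlongrightarrow> a \<bullet> l) (at_left t)" by (intro tendsto_intros)
  then show ?thesis
    using True l by (simp add: jump_def tendsto_Lim inner_diff_right)
qed (simp add: jump_def)

lemma cadlag_inner:
  fixes f :: "real \<Rightarrow> 'b::euclidean_space"
  assumes "cadlag f"
  shows "cadlag (\<lambda>t. a \<bullet> f t)"
  unfolding cadlag_def
proof (intro conjI allI impI)
  fix t :: real
  note right = conjunct1[OF assms[unfolded cadlag_def], rule_format]
    and left = conjunct2[OF assms[unfolded cadlag_def], rule_format]
  show "((\<lambda>t. a \<bullet> f t) \<longlongrightarrow> a \<bullet> f t) (at_right t)" if "0 \<le> t"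
    by (rule tendsto_inner[OF tendsto_const right[OF that]])
  show "\<exists>l. ((\<lambda>t. a \<bullet> f t) \<longlongrightarrow> l) (at_left t)" if "0 < t"
    using left[OF that] tendsto_inner[OF tendsto_const] by (elim exE) (rule exI)
qed

lemma levy_process_inner:
  fixes Z :: "real \<Rightarrow> 'w \<Rightarrow> 'b::euclidean_space"
  assumes "levy_process M Z"
  shows "levy_process M (\<lambda>t \<omega>. a \<bullet> Z t \<omega>)"
proof -
  interpret prob_space M using assms by (simp add: levy_process_def)
  have meas [measurable]: "Z t \<in> borel_measurable M" if "0 \<le> t" for t
    using assms that by (simp add: levy_process_def)
  have "indep_vars (\<lambda>_. borel) (\<lambda>i \<omega>. a \<bullet> Z (s (Suc i)) \<omega> - a \<bullet> Z (s i) \<omega>) {..<n}"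
    if "0 \<le> s 0" "mono s" for n and s :: "nat \<Rightarrow> real"
  proof -
    have "indep_vars (\<lambda>_. borel) (\<lambda>i \<omega>. Z (s (Suc i)) \<omega> - Z (s i) \<omega>) {..<n}"
      using assms that by (simp add: levy_process_def)
    from indep_vars_compose2[OF this, of "\<lambda>_ z. a \<bullet> z" "\<lambda>_. borel"] show ?thesis
      by (simp add: inner_diff_right)
  qed
  moreover have "distr M borel (\<lambda>\<omega>. a \<bullet> Z (s + h) \<omega> - a \<bullet> Z s \<omega>) = distr M borel (\<lambda>\<omega>. a \<bullet> Z h \<omega>)"
    if "0 \<le> s" "0 \<le> h" for s h
  proof -
    have [measurable]: "Z (s + h) \<in> borel_measurable M" "Z s \<in> borel_measurable M" "Z h \<in> borel_measurable M"
      using that meas by auto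
    have "distr (distr M borel (\<lambda>\<omega>. Z (s + h) \<omega> - Z s \<omega>)) borel (\<lambda>z. a \<bullet> z)
      = distr (distr M borel (Z h)) borel (\<lambda>z. a \<bullet> z)"
      using assms that by (simp add: levy_process_def)
    then show ?thesis by (simp add: distr_distr comp_def inner_diff_right)
  qed
  moreover have "AE \<omega> in M. a \<bullet> Z 0 \<omega> = 0"
  proof -
    have "AE \<omega> in M. Z 0 \<omega> = 0" using assms by (simp add: levy_process_def)
    then show ?thesis by eventually_elim simp
  qed
  moreover have "AE \<omega> in M. cadlag (\<lambda>t. a \<bullet> Z t \<omega>)"
  proof -
    have "AE \<omega> in M. cadlag (\<lambda>t. Z t \<omega>)" using assms by (simp add: levy_process_def)
    then show ?thesis by eventually_elim (rule cadlag_inner)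
  qed
  ultimately show ?thesis
    unfolding levy_process_def using prob_space_axioms borel_measurable_inner[OF borel_measurable_const meas]
    by blast
qed

lemma sets_natural_filtration:
  "sets (natural_filtration M X t) =
    sigma_sets (space M) {X s -` A \<inter> space M |s A. s \<in> {0..t} \<and> A \<in> sets borel}"
  unfolding natural_filtration_def by (rule sets_measure_of) auto

lemma space_natural_filtration [simp]: "space (natural_filtration M X t) = space M"
  unfolding natural_filtration_def by (rule space_measure_of) auto

lemma measurable_natural_filtration:
  fixes X :: "real \<Rightarrow> 'w \<Rightarrow> 'b::topological_space"
  assumes "0 \<le> s" "s \<le> t"
  shows "X s \<in> borel_measurable (natural_filtration M X t)"
proof (rule measurableI)
  fix A assume "A \<in> sets (borel :: 'b measure)"
  then show "X s -` A \<inter> space (natural_filtration M X t) \<in> sets (natural_filtration M X t)"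
    unfolding sets_natural_filtration space_natural_filtration
    using assms by (intro sigma_sets.Basic CollectI exI[of _ s] exI[of _ A]) simp
qed simp

lemma sets_natural_filtration_subset:
  assumes "\<And>s. 0 \<le> s \<Longrightarrow> s \<le> t \<Longrightarrow> X s \<in> borel_measurable N" "space N = space M"
  shows "sets (natural_filtration M X t) \<subseteq> sets N"
  unfolding sets_natural_filtration assms(2)[symmetric]
proof (rule sets.sigma_sets_subset, rule subsetI)
  fix B assume "B \<in> {X s -` A \<inter> space N |s A. s \<in> {0..t} \<and> A \<in> sets borel}"
  then obtain s A where "B = X s -` A \<inter> space N" "0 \<le> s" "s \<le> t" "A \<in> sets borel" by auto
  then show "B \<in> sets N" using measurable_sets[OF assms(1)] by simp
qed

text \<open>The filtration of the linear image is coarser than that of \<open>Z\<close>. Conditional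
  expectations are therefore compared through integrals over its sets, which also belong to the
  filtration of \<open>Z\<close>; there the martingale property of each coordinate applies, and the
  coordinates are summed with the weights \<open>a \<bullet> b\<close>.\<close>

lemma levy_martingale_inner:
  fixes Z :: "real \<Rightarrow> 'w \<Rightarrow> 'b::euclidean_space"
  assumes Z: "levy_martingale M Z"
  shows "levy_martingale M (\<lambda>t \<omega>. a \<bullet> Z t \<omega>)"
proof -
  let ?X = "\<lambda>t \<omega>. a \<bullet> Z t \<omega>"
  have levy: "levy_process M Z" and int: "\<And>t. 0 \<le> t \<Longrightarrow> integrable M (Z t)"
    using Z by (auto simp: levy_martingale_def)
  interpret prob_space M using levy by (simp add: levy_process_def)
  have meas: "Z t \<in> borel_measurable M" if "0 \<le> t" for t
    using levy that by (simp add: levy_process_def)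
  have "AE \<omega> in M. real_cond_exp M (natural_filtration M ?X s) (?X t) \<omega> = ?X s \<omega>"
    if st: "0 \<le> s" "s \<le> t" for s t
  proof -
    let ?F = "natural_filtration M ?X s" and ?H = "natural_filtration M Z s"
    have H: "subalgebra M ?H"
      unfolding subalgebra_def using meas by (simp add: sets_natural_filtration_subset)
    have FH: "sets ?F \<subseteq> sets ?H"
      by (intro sets_natural_filtration_subset borel_measurable_inner measurable_const)
        (simp_all add: measurable_natural_filtration)
    have F: "subalgebra M ?F"
      using H FH unfolding subalgebra_def by auto
    interpret H: finite_measure_subalgebra M ?H using H by unfold_locales
    interpret F: finite_measure_subalgebra M ?F using F by unfold_locales
    have t: "0 \<le> t" using st by simp
    show ?thesis
    proof (rule F.real_cond_exp_charact)
      show "integrable M (?X t)" "integrable M (?X s)" using int[OF t] int[OF st(1)] by simp_all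
      show "?X s \<in> borel_measurable ?F" using st by (intro measurable_natural_filtration[where X = ?X]) simp_all
      fix A assume A: "A \<in> sets ?F"
      then have AH: "A \<in> sets ?H" and AM: "A \<in> sets M"
        using FH F by (auto simp: subalgebra_def)
      have b: "(\<integral>\<omega>. indicator A \<omega> * (Z t \<omega> \<bullet> b) \<partial>M) = (\<integral>\<omega>. indicator A \<omega> * (Z s \<omega> \<bullet> b) \<partial>M)"
        if "b \<in> Basis" for b
      proof -
        have ae: "AE \<omega> in M. real_cond_exp M ?H (\<lambda>\<omega>. Z t \<omega> \<bullet> b) \<omega> = Z s \<omega> \<bullet> b"
          using Z that st by (simp add: levy_martingale_def)
        have "(\<integral>\<omega>. indicator A \<omega> * (Z t \<omega> \<bullet> b) \<partial>M)
          = (\<integral>\<omega>. indicator A \<omega> * real_cond_exp M ?H (\<lambda>\<omega>. Z t \<omega> \<bullet> b) \<omega> \<partial>M)"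
          using H.real_cond_exp_intA[OF _ AH, of "\<lambda>\<omega>. Z t \<omega> \<bullet> b"] int[OF t]
          by (simp add: set_lebesgue_integral_def)
        also have "\<dots> = (\<integral>\<omega>. indicator A \<omega> * (Z s \<omega> \<bullet> b) \<partial>M)"
          using ae AM meas[OF st(1)] by (intro integral_cong_AE) (auto elim!: eventually_mono)
        finally show ?thesis .
      qed
      have expand: "(\<integral>\<omega>\<in>A. ?X u \<omega> \<partial>M) = (\<Sum>b\<in>Basis. (a \<bullet> b) * (\<integral>\<omega>. indicator A \<omega> * (Z u \<omega> \<bullet> b) \<partial>M))"
        if "0 \<le> u" for u
      proof -
        have i: "integrable M (\<lambda>\<omega>. indicator A \<omega> * (Z u \<omega> \<bullet> b))" for b
          using integrable_mult_indicator[OF AM, of "\<lambda>\<omega>. Z u \<omega> \<bullet> b"] int[OF that] by simp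
        have "(\<integral>\<omega>\<in>A. ?X u \<omega> \<partial>M) = (\<integral>\<omega>. (\<Sum>b\<in>Basis. (a \<bullet> b) * (indicator A \<omega> * (Z u \<omega> \<bullet> b))) \<partial>M)"
          unfolding set_lebesgue_integral_def
          by (intro Bochner_Integration.integral_cong refl, subst euclidean_inner)
            (simp add: sum_distrib_left mult.left_commute)
        also have "\<dots> = (\<Sum>b\<in>Basis. (a \<bullet> b) * (\<integral>\<omega>. indicator A \<omega> * (Z u \<omega> \<bullet> b) \<partial>M))"
          using i by (simp add: integral_sum)
        finally show ?thesis .
      qed
      show "(\<integral>\<omega>\<in>A. ?X t \<omega> \<partial>M) = (\<integral>\<omega>\<in>A. ?X s \<omega> \<partial>M)"
        unfolding expand[OF t] expand[OF st(1)] using b by simp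
    qed
  qed
  then show ?thesis
    unfolding levy_martingale_def using levy_process_inner[OF levy] int by simp
qed

section \<open>Linear growth of the exponent and finite variation\<close>

lemma has_laplace_exponent_unique:
  assumes "has_laplace_exponent M X D J" "has_laplace_exponent M X D J'" "l \<in> D"
  shows "J l = J' l"
proof -
  have "exp (1 * J l) = exp (1 * J' l)"
    using assms unfolding has_laplace_exponent_def by (metis zero_le_one)
  then show ?thesis by simp
qed

lemma has_laplace_exponent_cong:
  assumes "has_laplace_exponent M X D J" "\<And>l. l \<in> D \<Longrightarrow> J l = J' l"
  shows "has_laplace_exponent M X D J'"
  using assms by (simp add: has_laplace_exponent_def)

text \<open>The function is f t + C t minus C t, a difference of nondecreasing functions. The
  function \<open>h\<close> of the proof is their sum, whence the factor 2, and its growth dominates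
  the variation.\<close>

lemma bounded_variation_drift:
  fixes f :: "real \<Rightarrow> real"
  assumes mono: "\<And>s t. 0 \<le> s \<Longrightarrow> s \<le> t \<Longrightarrow> f s + C * s \<le> f t + C * t" and "0 \<le> C"
  shows "bounded_variation f T"
  unfolding bounded_variation_def
proof (intro exI allI impI)
  fix n and s :: "nat \<Rightarrow> real"
  assume s: "mono s \<and> range s \<subseteq> {0..T}"
  define h where "h t = f t + 2 * C * t" for t
  have s_mono: "s i \<le> s j" if "i \<le> j" for i j using s that by (simp add: monoD)
  have s0: "0 \<le> s i" "s i \<le> T" for i using s by (auto simp: image_subset_iff)
  have "\<bar>f (s (Suc i)) - f (s i)\<bar> \<le> h (s (Suc i)) - h (s i)" for i
  proof -
    have "f (s i) + C * s i \<le> f (s (Suc i)) + C * s (Suc i)" using s0 s_mono by (intro mono) auto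
    moreover have "C * s i \<le> C * s (Suc i)" using s_mono \<open>0 \<le> C\<close> by (intro mult_left_mono) auto
    ultimately show ?thesis unfolding h_def by (simp add: abs_if)
  qed
  then have "(\<Sum>i<n. \<bar>f (s (Suc i)) - f (s i)\<bar>) \<le> (\<Sum>i<n. h (s (Suc i)) - h (s i))"
    by (intro sum_mono)
  also have "\<dots> = h (s n) - h (s 0)" by (rule sum_lessThan_telescope)
  also have "\<dots> \<le> h T - h 0"
  proof -
    have h_mono: "h u \<le> h v" if "0 \<le> u" "u \<le> v" for u v
      using mono[OF that] mult_left_mono[OF that(2) \<open>0 \<le> C\<close>] by (simp add: h_def)
    show ?thesis using h_mono[of "s n" T] h_mono[of 0 "s 0"] s0 by (simp add: diff_mono)
  qed
  finally show "(\<Sum>i<n. \<bar>f (s (Suc i)) - f (s i)\<bar>) \<le> h T - h 0" .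
qed

text \<open>Almost sure monotonicity is available for each fixed pair of times, and only countably
  many pairs can share one null set; right-continuity leads from rational to real times.\<close>

lemma right_continuous_mono_on_Rats:
  fixes f :: "real \<Rightarrow> real"
  assumes cont: "\<And>t. 0 \<le> t \<Longrightarrow> (f \<longlongrightarrow> f t) (at_right t)"
    and rat: "\<And>p q. p \<in> \<rat> \<Longrightarrow> q \<in> \<rat> \<Longrightarrow> 0 \<le> p \<Longrightarrow> p \<le> q \<Longrightarrow> f p \<le> f q"
    and st: "0 \<le> s" "s \<le> t"
  shows "f s \<le> f t"
proof (rule ccontr)
  assume neg: "\<not> f s \<le> f t"
  then have "s < t" using st by (cases "s = t") auto
  obtain m where m: "f t < m" "m < f s" using neg dense by (metis not_le)
  have "\<forall>\<^sub>F x in at_right s. m < f x" using cont[OF st(1)] m(2) by (rule order_tendstoD)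
  then obtain b where b: "s < b" "\<And>x. s < x \<Longrightarrow> x < b \<Longrightarrow> m < f x"
    unfolding eventually_at_right_field by blast
  have "\<forall>\<^sub>F x in at_right t. f x < m" using cont[of t] st m(1) by (intro order_tendstoD(2)) auto
  then obtain d where d: "t < d" "\<And>x. t < x \<Longrightarrow> x < d \<Longrightarrow> f x < m"
    unfolding eventually_at_right_field by blast
  obtain p where p: "p \<in> \<rat>" "s < p" "p < min b t" using Rats_dense_in_real[of s "min b t"] b(1) \<open>s < t\<close> by auto
  obtain q where q: "q \<in> \<rat>" "t < q" "q < d" using Rats_dense_in_real[OF d(1)] by auto
  have "f p \<le> f q" using p q st by (intro rat) auto
  then show False using b(2)[of p] d(2)[of q] p q by auto
qed

text \<open>With \<open>J \<beta> \<le> C \<beta>\<close> the Laplace transform of \<open>X t + C t\<close> is bounded by \<open>1\<close>, so this variable is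
  nonnegative and \<open>t \<mapsto> X t + C t\<close> is nondecreasing.\<close>

lemma laplace_exponent_linear_bound_nonneg:
  assumes "prob_space M" and X: "X t \<in> borel_measurable M" and "0 \<le> t"
    and J: "has_laplace_exponent M X {0..} J" and bound: "\<And>\<beta>. 0 \<le> \<beta> \<Longrightarrow> J \<beta> \<le> C * \<beta>"
  shows "AE \<omega> in M. 0 \<le> X t \<omega> + C * t"
proof -
  interpret prob_space M by fact
  have small: "AE \<omega> in M. - e < X t \<omega> + C * t" if "0 < e" for e
  proof -
    define A where "A = {\<omega> \<in> space M. X t \<omega> + C * t \<le> - e}"
    have A: "A \<in> sets M" unfolding A_def using X by measurable
    have "prob A \<le> exp (- e) ^ n" for n :: nat
    proof -
      let ?\<beta> = "real n"
      have int: "integrable M (\<lambda>\<omega>. exp (- (?\<beta> * X t \<omega>)))"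
        and val: "(\<integral>\<omega>. exp (- (?\<beta> * X t \<omega>)) \<partial>M) = exp (t * J ?\<beta>)"
        using J \<open>0 \<le> t\<close> by (auto simp: has_laplace_exponent_def)
      \<comment> \<open>Markov's inequality for exp(-n X t): on \<open>A\<close> the variable X t is
        at most -C t - e. Large n will make the bound arbitrarily small.\<close>
      have "prob A * exp (?\<beta> * (C * t + e)) = (\<integral>\<omega>. indicator A \<omega> * exp (?\<beta> * (C * t + e)) \<partial>M)"
        using A by simp
      also have "\<dots> \<le> (\<integral>\<omega>. exp (- (?\<beta> * X t \<omega>)) \<partial>M)"
      proof (rule integral_mono)
        show "integrable M (\<lambda>\<omega>. indicator A \<omega> * exp (?\<beta> * (C * t + e)))"
          using A by (intro integrable_mult_left) (simp add: integrable_indicator_iff emeasure_eq_measure)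
        show "indicator A \<omega> * exp (?\<beta> * (C * t + e)) \<le> exp (- (?\<beta> * X t \<omega>))" for \<omega>
        proof (cases "\<omega> \<in> A")
          case True
          then have "?\<beta> * (C * t + e) \<le> ?\<beta> * (- X t \<omega>)"
            unfolding A_def by (intro mult_left_mono) auto
          then show ?thesis using True by simp
        qed simp
      qed (rule int)
      also have "\<dots> \<le> exp (?\<beta> * (C * t))"
        using bound[of ?\<beta>] mult_left_mono[OF bound[of ?\<beta>] \<open>0 \<le> t\<close>] unfolding val
        by (simp add: ac_simps)
      finally have "prob A * exp (?\<beta> * e) \<le> 1"
        by (simp add: distrib_left exp_add)
      then show ?thesis
        by (simp add: exp_minus exp_of_nat_mult[symmetric] field_simps)
    qed
    moreover have "(\<lambda>n. exp (- e) ^ n) \<longlonglongrightarrow> 0" using that by (intro LIMSEQ_realpow_zero) auto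
    ultimately have "prob A \<le> 0" by (intro LIMSEQ_le_const[of _ 0]) auto
    then have "A \<in> null_sets M"
      using A by (auto simp: emeasure_eq_measure measure_le_0_iff)
    then have "AE \<omega> in M. \<omega> \<notin> A" by (rule AE_not_in)
    then show ?thesis using AE_space by eventually_elim (auto simp: A_def)
  qed
  have "AE \<omega> in M. \<forall>n::nat. - (1 / real (Suc n)) < X t \<omega> + C * t"
    unfolding AE_all_countable by (intro allI small) simp
  then show ?thesis
  proof eventually_elim
    case (elim \<omega>)
    show ?case
    proof (rule ccontr)
      assume "\<not> ?case"
      then obtain n where "1 / real (Suc n) < - (X t \<omega> + C * t)"
        using nat_approx_posE[of "- (X t \<omega> + C * t)"] by auto
      then show False using elim by (smt (verit))
    qed
  qed
qed

text \<open>By stationarity the nonnegativity of X (q - p) + C (q - p) is a statement on increments: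
  paths with the added drift are nondecreasing.\<close>

lemma laplace_exponent_linear_bound:
  assumes levy: "levy_process M X" and J: "has_laplace_exponent M X {0..} J"
    and bound: "\<And>\<beta>. 0 \<le> \<beta> \<Longrightarrow> J \<beta> \<le> C * \<beta>" and "0 \<le> C"
  shows "\<not> infinite_variation M X"
proof -
  interpret prob_space M using levy by (simp add: levy_process_def)
  have meas: "X t \<in> borel_measurable M" if "0 \<le> t" for t
    using levy that by (simp add: levy_process_def)
  have incr: "AE \<omega> in M. X p \<omega> + C * p \<le> X q \<omega> + C * q" if "0 \<le> p" "p \<le> q" for p q
  proof -
    have [measurable]: "X q \<in> borel_measurable M" "X p \<in> borel_measurable M" "X (q - p) \<in> borel_measurable M"
      using meas that by auto
    have "distr M borel (\<lambda>\<omega>. X (p + (q - p)) \<omega> - X p \<omega>) = distr M borel (X (q - p))"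
      using levy that unfolding levy_process_def by (metis diff_ge_0_iff_ge)
    then have eq: "distr M borel (\<lambda>\<omega>. X q \<omega> - X p \<omega>) = distr M borel (X (q - p))" by simp
    have "AE y in distr M borel (X (q - p)). 0 \<le> y + C * (q - p)"
      using laplace_exponent_linear_bound_nonneg[OF prob_space_axioms meas _ J bound] that
      by (subst AE_distr_iff) auto
    then have "AE y in distr M borel (\<lambda>\<omega>. X q \<omega> - X p \<omega>). 0 \<le> y + C * (q - p)" unfolding eq .
    then have "AE \<omega> in M. 0 \<le> X q \<omega> - X p \<omega> + C * (q - p)"
      by (subst (asm) AE_distr_iff) auto
    then show ?thesis by eventually_elim (simp add: algebra_simps)
  qed
  have "AE \<omega> in M. \<forall>p\<in>\<rat>. \<forall>q\<in>\<rat>. 0 \<le> p \<longrightarrow> p \<le> q \<longrightarrow> X p \<omega> + C * p \<le> X q \<omega> + C * q"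
    by (simp add: AE_ball_countable[OF countable_rat] incr)
  moreover have "AE \<omega> in M. cadlag (\<lambda>t. X t \<omega>)" using levy by (simp add: levy_process_def)
  ultimately have "AE \<omega> in M. \<forall>T\<ge>0. bounded_variation (\<lambda>t. X t \<omega>) T"
  proof eventually_elim
    case (elim \<omega>)
    have "((\<lambda>t. X t \<omega> + C * t) \<longlongrightarrow> X t \<omega> + C * t) (at_right t)" if "0 \<le> t" for t
      using elim(2) that unfolding cadlag_def by (intro tendsto_intros) auto
    then have "X s \<omega> + C * s \<le> X t \<omega> + C * t" if "0 \<le> s" "s \<le> t" for s t
      using right_continuous_mono_on_Rats[of "\<lambda>t. X t \<omega> + C * t" s t] elim(1) that by blast
    then show ?case using \<open>0 \<le> C\<close> by (blast intro: bounded_variation_drift)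
  qed
  then show ?thesis by (simp add: infinite_variation_def)
qed

section \<open>Generating pairs and Laplace exponents\<close>

text \<open>Every \<open>y\<close> orthogonal to \<open>g\<close> is projected to 0, where even
  infinite mass may accumulate. The restriction discards it; the generating-pair condition looks at
  the open half-line, and integrals of \<open>psi\<close> agree because
  \<open>psi 0 = 0\<close>.\<close>

definition positive_part_measure :: "(real^'n) measure \<Rightarrow> real^'n \<Rightarrow> real measure" where
  "positive_part_measure \<nu> g = density (projected_measure \<nu> g) (indicator {0<..})"

lemma inner_vec2: "l \<bullet> z = l $ 1 * z $ 1 + l $ 2 * z $ 2" for l z :: "real^2"
  by (simp add: inner_vec_def sum_2)

text \<open>By Cauchy-Schwarz, projections inherit the integrability of the jump measure.\<close>

lemma inner_min_le:
  fixes g y :: "'a::real_inner"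
  assumes "0 \<le> g \<bullet> y"
  shows "min (g \<bullet> y) ((g \<bullet> y)\<^sup>2) \<le> max (norm g) ((norm g)\<^sup>2) * min (norm y) ((norm y)\<^sup>2)"
proof -
  have le: "g \<bullet> y \<le> norm g * norm y" by (rule norm_cauchy_schwarz)
  then have "min (g \<bullet> y) ((g \<bullet> y)\<^sup>2) \<le> min (norm g * norm y) ((norm g * norm y)\<^sup>2)"
    using assms by (intro min.mono power_mono)
  also have "\<dots> \<le> max (norm g) ((norm g)\<^sup>2) * min (norm y) ((norm y)\<^sup>2)"
    by (intro min_mult_le) auto
  finally show ?thesis .
qed

lemma in_orthant: "0 \<le> l $ 1 \<Longrightarrow> 0 \<le> l $ 2 \<Longrightarrow> l \<in> {l. \<forall>i. 0 \<le> l $ i}" for l :: "real^2"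
  by (auto simp: forall_2)

section \<open>The planar Levy martingale and its joint exponent\<close>

locale planar_levy_martingale =
  fixes M :: "'w measure" and Z :: "real \<Rightarrow> 'w \<Rightarrow> real^2"
    and Q :: "real^2^2" and \<nu> :: "(real^2) measure" and J1 J2 :: "real \<Rightarrow> real"
  assumes martingale: "levy_martingale M Z"
    and nonneg: "nonneg_jumps M (\<lambda>t \<omega>. Z t \<omega> $ 1)" "nonneg_jumps M (\<lambda>t \<omega>. Z t \<omega> $ 2)"
    and indep: "independent_processes M (\<lambda>t \<omega>. Z t \<omega> $ 1) (\<lambda>t \<omega>. Z t \<omega> $ 2)"
    and infinite_var: "infinite_variation M (\<lambda>t \<omega>. Z t \<omega> $ 1)" "infinite_variation M (\<lambda>t \<omega>. Z t \<omega> $ 2)"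
    and characteristics: "levy_characteristics M Z Q \<nu>"
    and laplace1: "has_laplace_exponent M (\<lambda>t \<omega>. Z t \<omega> $ 1) {0..} J1"
    and laplace2: "has_laplace_exponent M (\<lambda>t \<omega>. Z t \<omega> $ 2) {0..} J2"
begin

lemma levy: "levy_process M Z"
  using martingale by (simp add: levy_martingale_def)

sublocale prob_space M
  using levy by (simp add: levy_process_def)

lemma sets_\<nu> [measurable_cong]: "sets \<nu> = sets borel"
  using characteristics by (simp add: levy_characteristics_def is_levy_measure_def)

lemma space_\<nu> [simp]: "space \<nu> = UNIV"
  using sets_eq_imp_space_eq[OF sets_\<nu>] by simp

lemma AE_cadlag: "AE \<omega> in M. cadlag (\<lambda>t. Z t \<omega>)"
  using levy by (simp add: levy_process_def)

lemma AE_jump_nonneg: "AE \<omega> in M. \<forall>t\<ge>0. 0 \<le> jump (\<lambda>s. Z s \<omega>) t $ 1 \<and> 0 \<le> jump (\<lambda>s. Z s \<omega>) t $ 2"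
  using nonneg[unfolded nonneg_jumps_def] AE_cadlag
proof eventually_elim
  case (elim \<omega>)
  have "jump (\<lambda>s. Z s \<omega> $ i) t = jump (\<lambda>s. Z s \<omega>) t $ i" for t i
    using jump_inner[OF elim(3), of "axis i 1" t] by (simp add: inner_axis')
  then show ?case using elim by simp
qed

lemma nonneg_jumps_inner:
  assumes "0 \<le> g $ 1" "0 \<le> g $ 2"
  shows "nonneg_jumps M (\<lambda>t \<omega>. g \<bullet> Z t \<omega>)"
  unfolding nonneg_jumps_def using AE_jump_nonneg AE_cadlag
proof eventually_elim
  case (elim \<omega>)
  have "0 \<le> g \<bullet> jump (\<lambda>s. Z s \<omega>) t" if "0 \<le> t" for t
    using elim(1) that assms by (simp add: inner_vec2)
  then show ?case unfolding jump_inner[OF elim(2)] by blast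
qed

text \<open>The Levy measure of a set is an expected number of jumps, and almost surely no jump has
  a negative coordinate.\<close>

lemma AE_\<nu>_coord_nonneg: "AE y in \<nu>. \<forall>i. 0 \<le> y $ i"
proof (rule AE_I)
  let ?N = "{y :: real^2. \<exists>i. y $ i < 0}"
  show "{y \<in> space \<nu>. \<not> (\<forall>i. 0 \<le> y $ i)} \<subseteq> ?N" by (auto simp: not_le)
  have N: "?N \<in> sets borel" by measurable
  then show "?N \<in> sets \<nu>" by (simp only: sets_\<nu>)
  have empty: "{t\<in>{0<..1}. jump (\<lambda>s. Z s \<omega>) t \<in> ?N - {0}} = {}"
    if "\<forall>t\<ge>0. 0 \<le> jump (\<lambda>s. Z s \<omega>) t $ 1 \<and> 0 \<le> jump (\<lambda>s. Z s \<omega>) t $ 2" for \<omega>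
  proof -
    have "\<forall>i. 0 \<le> jump (\<lambda>s. Z s \<omega>) t $ i" if "0 < t" for t
      unfolding forall_2 using \<open>\<forall>t\<ge>0. _ t\<close> that by (meson less_imp_le)
    then show ?thesis by (auto dest: leD)
  qed
  have "emeasure \<nu> ?N = (\<integral>\<^sup>+\<omega>. emeasure (count_space UNIV)
      {t\<in>{0<..1}. jump (\<lambda>s. Z s \<omega>) t \<in> ?N - {0}} \<partial>M)"
    by (rule bspec[OF conjunct2[OF conjunct1[OF
            characteristics[unfolded levy_characteristics_def is_levy_measure_def]]] N])
  also have "\<dots> = (\<integral>\<^sup>+\<omega>. 0 \<partial>M)"
  proof (rule nn_integral_cong_AE, use AE_jump_nonneg in eventually_elim)
    case (elim \<omega>)
    show ?case unfolding empty[OF elim] by (rule emeasure_empty)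
  qed
  finally show "emeasure \<nu> ?N = 0" by simp
qed

lemma AE_inner_nonneg:
  assumes "0 \<le> g $ 1" "0 \<le> g $ 2"
  shows "AE y in \<nu>. 0 \<le> g \<bullet> y"
  using AE_\<nu>_coord_nonneg by eventually_elim (simp add: inner_vec2 assms)

lemma integrable_norm_min: "integrable \<nu> (\<lambda>y. min (norm y) ((norm y)\<^sup>2))"
  using characteristics by (intro integrableI_nonneg) (auto simp: levy_characteristics_def)

lemma integrable_psi_inner:
  assumes "0 \<le> g $ 1" "0 \<le> g $ 2"
  shows "integrable \<nu> (\<lambda>y. psi (g \<bullet> y))"
proof (rule Bochner_Integration.integrable_bound)
  show "integrable \<nu> (\<lambda>y. max (norm g) ((norm g)\<^sup>2) * min (norm y) ((norm y)\<^sup>2))"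
    using integrable_norm_min by simp
  show "AE y in \<nu>. norm (psi (g \<bullet> y)) \<le> norm (max (norm g) ((norm g)\<^sup>2) * min (norm y) ((norm y)\<^sup>2))"
    using AE_inner_nonneg[OF assms]
  proof eventually_elim
    case (elim y)
    have "psi (g \<bullet> y) \<le> max (norm g) ((norm g)\<^sup>2) * min (norm y) ((norm y)\<^sup>2)"
      using order_trans[OF psi_le_min[OF elim] inner_min_le[OF elim]] .
    also have "\<dots> \<le> \<bar>max (norm g) ((norm g)\<^sup>2) * min (norm y) ((norm y)\<^sup>2)\<bar>" by (rule abs_ge_self)
    finally show ?case by (simp only: real_norm_def abs_of_nonneg[OF psi_nonneg])
  qed
qed measurable

text \<open>The joint Laplace exponent of \<open>Z\<close>, meaningful on the nonnegative orthant
  and expressed by the characteristics.\<close>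

definition expo :: "real^2 \<Rightarrow> real" where
  "expo l = 1/2 * ((Q *v l) \<bullet> l) + (\<integral>y. psi (l \<bullet> y) \<partial>\<nu>)"

lemma laplace: "has_laplace_exponent M Z {l. \<forall>i. 0 \<le> l $ i} expo"
  using characteristics by (simp add: levy_characteristics_def expo_def[abs_def] psi_def)

lemma Q_nonneg: "0 \<le> (Q *v u) \<bullet> u"
  using characteristics by (simp add: levy_characteristics_def)

lemma Q_scaleR: "(Q *v (c *\<^sub>R u)) \<bullet> (c *\<^sub>R u) = c\<^sup>2 * ((Q *v u) \<bullet> u)"
  by (simp add: matrix_vector_mult_scaleR power2_eq_square)

lemma expo_nonneg: "0 \<le> expo l"
  unfolding expo_def using Q_nonneg[of l] by simp

text \<open>Convexity along a ray, with value 0 at the origin. It makes \<open>J2\<close> tend to 0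
  at zero, where the iteration for the functional equation ends.\<close>

lemma expo_scale_le:
  assumes "0 \<le> g $ 1" "0 \<le> g $ 2" "0 \<le> c" "c \<le> 1"
  shows "expo (c *\<^sub>R g) \<le> c * expo g"
proof -
  have "c\<^sup>2 \<le> c" using assms by (simp add: power2_eq_square mult_left_le)
  then have "c\<^sup>2 * ((Q *v g) \<bullet> g) \<le> c * ((Q *v g) \<bullet> g)"
    by (intro mult_right_mono Q_nonneg)
  moreover have "(\<integral>y. psi ((c *\<^sub>R g) \<bullet> y) \<partial>\<nu>) \<le> (\<integral>y. c * psi (g \<bullet> y) \<partial>\<nu>)"
    using assms integrable_psi_inner[of g] integrable_psi_inner[of "c *\<^sub>R g"]
    by (intro integral_mono) (auto intro: psi_mult_le)
  ultimately show ?thesis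
    unfolding expo_def Q_scaleR by (simp add: algebra_simps)
qed

text \<open>Independence concerns entire paths; evaluating them at time 1 and exponentiating gives
  independent factors, whose expectations multiply.\<close>

lemma expo_eq:
  assumes "0 \<le> l $ 1" "0 \<le> l $ 2"
  shows "expo l = J1 (l $ 1) + J2 (l $ 2)"
proof -
  have ind: "indep_var borel ((\<lambda>f. exp (- (l $ 1 * f 1))) \<circ> (\<lambda>\<omega>. \<lambda>t\<in>{0..}. Z t \<omega> $ 1))
      borel ((\<lambda>f. exp (- (l $ 2 * f 1))) \<circ> (\<lambda>\<omega>. \<lambda>t\<in>{0..}. Z t \<omega> $ 2))"
    using indep unfolding independent_processes_def
  proof (rule indep_var_compose)
    have [measurable]: "(\<lambda>f. f 1) \<in> borel_measurable (PiM {0::real..} (\<lambda>_. borel :: real measure))"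
      by (rule measurable_component_singleton) simp
    show "(\<lambda>f. exp (- (l $ 1 * f 1))) \<in> borel_measurable (PiM {0::real..} (\<lambda>_. borel :: real measure))"
      "(\<lambda>f. exp (- (l $ 2 * f 1))) \<in> borel_measurable (PiM {0::real..} (\<lambda>_. borel :: real measure))"
      by measurable
  qed
  have "exp (1 * expo l) = (\<integral>\<omega>. exp (- (l \<bullet> Z 1 \<omega>)) \<partial>M)"
    using laplace in_orthant[OF assms] by (simp add: has_laplace_exponent_def)
  also have "\<dots> = (\<integral>\<omega>. exp (- (l $ 1 * Z 1 \<omega> $ 1)) * exp (- (l $ 2 * Z 1 \<omega> $ 2)) \<partial>M)"
    by (simp add: inner_vec2 exp_add[symmetric])
  also have "\<dots> = (\<integral>\<omega>. exp (- (l $ 1 * Z 1 \<omega> $ 1)) \<partial>M) * (\<integral>\<omega>. exp (- (l $ 2 * Z 1 \<omega> $ 2)) \<partial>M)"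
  proof -
    have "integrable M (\<lambda>\<omega>. exp (- (l $ 1 * Z 1 \<omega> $ 1)))" "integrable M (\<lambda>\<omega>. exp (- (l $ 2 * Z 1 \<omega> $ 2)))"
      using laplace1 laplace2 assms by (auto simp: has_laplace_exponent_def)
    then show ?thesis
      using indep_var_lebesgue_integral[OF ind] by (simp add: comp_def)
  qed
  also have "\<dots> = exp (1 * J1 (l $ 1)) * exp (1 * J2 (l $ 2))"
    using laplace1 laplace2 assms by (simp add: has_laplace_exponent_def)
  finally have "exp (expo l) = exp (J1 (l $ 1) + J2 (l $ 2))" by (simp add: exp_add)
  then show ?thesis by simp
qed

lemma J_zero: "J1 0 = 0" "J2 0 = 0"
proof -
  have "exp (1 * J1 0) = (\<integral>\<omega>. exp (- (0 \<bullet> Z 1 \<omega> $ 1)) \<partial>M)"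
    "exp (1 * J2 0) = (\<integral>\<omega>. exp (- (0 \<bullet> Z 1 \<omega> $ 2)) \<partial>M)"
    using laplace1 laplace2 unfolding has_laplace_exponent_def
    by (metis atLeast_iff order_refl zero_le_one)+
  then have "exp (J1 0) = 1" "exp (J2 0) = 1"
    by (simp_all add: prob_space)
  then show "J1 0 = 0" "J2 0 = 0" by auto
qed

lemma J_eq_expo: "0 \<le> u \<Longrightarrow> J1 u = expo (u *\<^sub>R axis 1 1)" "0 \<le> u \<Longrightarrow> J2 u = expo (u *\<^sub>R axis 2 1)"
  by (simp_all add: expo_eq J_zero axis_def)

lemma J_nonneg: "0 \<le> u \<Longrightarrow> 0 \<le> J1 u" "0 \<le> u \<Longrightarrow> 0 \<le> J2 u"
  by (simp_all add: J_eq_expo expo_nonneg)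

lemma J2_tendsto_0: "(J2 \<longlongrightarrow> 0) (at_right 0)"
proof (rule tendsto_sandwich)
  have "\<forall>\<^sub>F u in at_right 0. u \<in> {0<..<1::real}"
    by (rule eventually_at_right_real) simp
  then show "\<forall>\<^sub>F u in at_right 0. J2 u \<le> u * J2 1"
  proof eventually_elim
    case (elim u)
    then show ?case
      using expo_scale_le[of "axis 2 1" u] J_eq_expo(2)[of u] J_eq_expo(2)[of 1] by (simp add: axis_def)
  qed
  show "\<forall>\<^sub>F u in at_right 0. 0 \<le> J2 u"
    using eventually_at_right_less[of 0] by eventually_elim (simp add: J_nonneg)
  have "((\<lambda>u. u * J2 1) \<longlongrightarrow> 0 * J2 1) (at_right 0)" by (intro tendsto_intros)
  then show "((\<lambda>u. u * J2 1) \<longlongrightarrow> 0) (at_right 0)" by simp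
qed simp

lemma levy_martingale_coord: "levy_martingale M (\<lambda>t \<omega>. Z t \<omega> $ i)"
  using levy_martingale_inner[OF martingale, of "axis i 1"] by (simp add: inner_axis')

lemma laplace_inner:
  assumes "0 \<le> g $ 1" "0 \<le> g $ 2"
  shows "has_laplace_exponent M (\<lambda>t \<omega>. g \<bullet> Z t \<omega>) {0..} (\<lambda>\<beta>. J1 (\<beta> * g $ 1) + J2 (\<beta> * g $ 2))"
  unfolding has_laplace_exponent_def
proof (intro ballI allI impI)
  fix \<beta> t :: real assume b: "\<beta> \<in> {0..}" and t: "0 \<le> t"
  then have "\<beta> *\<^sub>R g \<in> {l. \<forall>i. 0 \<le> l $ i}" using assms by (intro in_orthant) auto
  moreover have "expo (\<beta> *\<^sub>R g) = J1 (\<beta> * g $ 1) + J2 (\<beta> * g $ 2)"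
    using assms b by (subst expo_eq) auto
  moreover have "(\<beta> *\<^sub>R g) \<bullet> z = \<beta> \<bullet> (g \<bullet> z)" for z by simp
  ultimately show "integrable M (\<lambda>\<omega>. exp (- (\<beta> \<bullet> (g \<bullet> Z t \<omega>)))) \<and>
      (\<integral>\<omega>. exp (- (\<beta> \<bullet> (g \<bullet> Z t \<omega>))) \<partial>M) = exp (t * (J1 (\<beta> * g $ 1) + J2 (\<beta> * g $ 2)))"
    using bspec[OF laplace[unfolded has_laplace_exponent_def], rule_format, of "\<beta> *\<^sub>R g" t] t by simp
qed

lemma sets_projected: "sets (projected_measure \<nu> g) = sets borel"
  by (simp add: projected_measure_def)

lemma sets_positive_part [measurable_cong]: "sets (positive_part_measure \<nu> g) = sets borel"
  by (simp add: positive_part_measure_def sets_projected)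

lemma emeasure_positive_part:
  assumes "A \<in> sets borel"
  shows "emeasure (positive_part_measure \<nu> g) A = emeasure (projected_measure \<nu> g) (A \<inter> {0<..})"
proof -
  have "emeasure (positive_part_measure \<nu> g) A
    = (\<integral>\<^sup>+v. indicator {0<..} v * indicator A v \<partial>projected_measure \<nu> g)"
    unfolding positive_part_measure_def using assms
    by (intro emeasure_density) (simp_all add: projected_measure_def)
  also have "\<dots> = (\<integral>\<^sup>+v. indicator (A \<inter> {0<..}) v \<partial>projected_measure \<nu> g)"
    by (intro nn_integral_cong) (simp only: indicator_inter_arith mult.commute)
  also have "\<dots> = emeasure (projected_measure \<nu> g) (A \<inter> {0<..})"
    using assms by (intro nn_integral_indicator) (simp add: sets_projected)
  finally show ?thesis .
qed

lemma nn_integral_positive_part: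
  assumes [measurable]: "f \<in> borel_measurable borel"
  shows "(\<integral>\<^sup>+v. f v \<partial>positive_part_measure \<nu> g) = (\<integral>\<^sup>+y. indicator {0<..} (g \<bullet> y) * f (g \<bullet> y) \<partial>\<nu>)"
proof -
  have "(\<integral>\<^sup>+v. f v \<partial>positive_part_measure \<nu> g) = (\<integral>\<^sup>+v. indicator {0<..} v * f v \<partial>projected_measure \<nu> g)"
    unfolding positive_part_measure_def
    by (rule nn_integral_density) (simp_all add: projected_measure_def)
  also have "\<dots> = (\<integral>\<^sup>+y. indicator {0<..} (g \<bullet> y) * f (g \<bullet> y) \<partial>\<nu>)"
    unfolding projected_measure_def by (rule nn_integral_distr) measurable
  finally show ?thesis .
qed

text \<open>Points with g \<bullet> y = 0 contribute \<open>psi 0 = 0\<close>, and those with a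
  negative product form a null set.\<close>

lemma integral_psi_positive_part:
  assumes "0 \<le> g $ 1" "0 \<le> g $ 2"
  shows "(\<integral>v. psi (\<beta> * v) \<partial>positive_part_measure \<nu> g) = (\<integral>y. psi (\<beta> * (g \<bullet> y)) \<partial>\<nu>)"
proof -
  have "(\<integral>\<^sup>+v. ennreal (psi (\<beta> * v)) \<partial>positive_part_measure \<nu> g)
    = (\<integral>\<^sup>+y. indicator {0<..} (g \<bullet> y) * ennreal (psi (\<beta> * (g \<bullet> y))) \<partial>\<nu>)"
    by (rule nn_integral_positive_part) measurable
  also have "\<dots> = (\<integral>\<^sup>+y. ennreal (psi (\<beta> * (g \<bullet> y))) \<partial>\<nu>)"
    using AE_inner_nonneg[OF assms]
    by (intro nn_integral_cong_AE) (auto elim!: eventually_mono simp: indicator_def order_le_less)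
  finally show ?thesis by (simp add: integral_eq_nn_integral)
qed

text \<open>Along the ray of \<open>g\<close> the joint exponent takes the one-dimensional
  Levy-Khintchine form, to which \<open>J_tilde_unique\<close> applies.\<close>

lemma expo_eq_J_tilde:
  assumes "0 \<le> g $ 1" "0 \<le> g $ 2"
  shows "expo (\<beta> *\<^sub>R g) = J_tilde (1/2 * ((Q *v g) \<bullet> g)) (positive_part_measure \<nu> g) \<beta>"
  unfolding expo_def J_tilde_eq_psi Q_scaleR integral_psi_positive_part[OF assms] by simp

lemma levy_measure_positive_part: "levy_measure_on_Ioi (positive_part_measure \<nu> g)"
proof
  show "sets (positive_part_measure \<nu> g) = sets borel" by (rule sets_positive_part)
  have "{..0} \<inter> {0<..} = ({} :: real set)" by auto
  then show "emeasure (positive_part_measure \<nu> g) {..0} = 0"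
    by (simp add: emeasure_positive_part)
  have "(\<integral>\<^sup>+v. ennreal (min v (v\<^sup>2)) \<partial>positive_part_measure \<nu> g)
    = (\<integral>\<^sup>+y. indicator {0<..} (g \<bullet> y) * ennreal (min (g \<bullet> y) ((g \<bullet> y)\<^sup>2)) \<partial>\<nu>)"
    by (rule nn_integral_positive_part) measurable
  also have "\<dots> \<le> (\<integral>\<^sup>+y. ennreal (max (norm g) ((norm g)\<^sup>2) * min (norm y) ((norm y)\<^sup>2)) \<partial>\<nu>)"
    by (intro nn_integral_mono) (auto simp: indicator_def intro!: ennreal_leI inner_min_le)
  also have "\<dots> < \<infinity>"
    using integrable_mult_right[OF integrable_norm_min, of "max (norm g) ((norm g)\<^sup>2)"]
    by (subst nn_integral_eq_integral) (auto intro!: mult_nonneg_nonneg simp: le_max_iff_disj)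
  finally show "(\<integral>\<^sup>+v. ennreal (min v (v\<^sup>2)) \<partial>positive_part_measure \<nu> g) < \<infinity>" .
qed

section \<open>The generating-pair condition as a functional equation\<close>

lemma not_expo_linear_bound:
  assumes g: "0 \<le> g $ 1" "0 \<le> g $ 2" and bound: "\<And>\<beta>. 0 \<le> \<beta> \<Longrightarrow> expo (\<beta> *\<^sub>R g) \<le> C * \<beta>" and "0 \<le> C"
  shows "g = 0"
proof -
  have expo: "expo (\<beta> *\<^sub>R g) = J1 (\<beta> * g $ 1) + J2 (\<beta> * g $ 2)" if "0 \<le> \<beta>" for \<beta>
    using g that by (subst expo_eq) auto
  have lev: "levy_process M (\<lambda>t \<omega>. Z t \<omega> $ i)" for i
    using levy_martingale_coord by (simp add: levy_martingale_def)
  have "g $ 1 = 0"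
  proof (rule ccontr)
    assume "g $ 1 \<noteq> 0"
    then have pos: "0 < g $ 1" using g by simp
    \<comment> \<open>The other exponent is nonnegative, so a bound on the sum is a bound on
      \<open>J1\<close>.\<close>
    have "J1 \<beta> \<le> C / g $ 1 * \<beta>" if "0 \<le> \<beta>" for \<beta>
      using bound[of "\<beta> / g $ 1"] expo[of "\<beta> / g $ 1"] J_nonneg(2)[of "\<beta> / g $ 1 * g $ 2"] that pos g by simp
    then show False
      using laplace_exponent_linear_bound[OF lev laplace1, of "C / g $ 1"] infinite_var(1) pos \<open>0 \<le> C\<close> by simp
  qed
  moreover have "g $ 2 = 0"
  proof (rule ccontr)
    assume "g $ 2 \<noteq> 0"
    then have pos: "0 < g $ 2" using g by simp
    have "J2 \<beta> \<le> C / g $ 2 * \<beta>" if "0 \<le> \<beta>" for \<beta>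
      using bound[of "\<beta> / g $ 2"] expo[of "\<beta> / g $ 2"] J_nonneg(1)[of "\<beta> / g $ 2 * g $ 1"] that pos g by simp
    then show False
      using laplace_exponent_linear_bound[OF lev laplace2, of "C / g $ 2"] infinite_var(2) pos \<open>0 \<le> C\<close> by simp
  qed
  ultimately show ?thesis by (simp add: vec_eq_iff forall_2)
qed

text \<open>At x = 0 the Wiener part vanishes and the projected jumps have a finite first moment.
  Since \<open>psi s\<close> is at most s for s \<ge> 0, the exponent along \<open>G 0\<close> grows
  at most linearly.\<close>

lemma generating_pair_zero:
  assumes G: "0 \<le> G 0 $ 1" "0 \<le> G 0 $ 2" and pair: "generating_pair_with M Z Q \<nu> G c \<mu>"
  shows "G 0 = 0"
proof -
  let ?P = "positive_part_measure \<nu> (G 0)"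
  interpret P: levy_measure_on_Ioi ?P by (rule levy_measure_positive_part)
  have "(\<integral>\<^sup>+v. ennreal v \<partial>?P) = (\<integral>\<^sup>+v\<in>{0<..}. ennreal v \<partial>projected_measure \<nu> (G 0))"
    unfolding positive_part_measure_def
    by (subst nn_integral_density) (auto simp: projected_measure_def mult.commute)
  also have "\<dots> < \<infinity>" using pair by (simp add: generating_pair_with_def)
  finally have int: "integrable ?P (\<lambda>v. v)"
    using P.AE_pos by (intro integrableI_nonneg) (auto elim!: eventually_mono)
  have "(Q *v G 0) \<bullet> G 0 = 0" using pair by (simp add: generating_pair_with_def)
  moreover have "(\<integral>v. psi (\<beta> * v) \<partial>?P) \<le> (\<integral>v. v \<partial>?P) * \<beta>" if "0 \<le> \<beta>" for \<beta>
  proof -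
    have "(\<integral>v. psi (\<beta> * v) \<partial>?P) \<le> (\<integral>v. \<beta> * v \<partial>?P)"
    proof (rule integral_mono_AE)
      show "AE v in ?P. psi (\<beta> * v) \<le> \<beta> * v"
        using P.AE_pos
      proof eventually_elim
        case (elim v)
        then show ?case using psi_le_min[of "\<beta> * v"] that by simp
      qed
    qed (use P.integrable_psi int that in auto)
    then show ?thesis by (simp add: mult.commute)
  qed
  ultimately have "expo (\<beta> *\<^sub>R G 0) \<le> (\<integral>v. v \<partial>?P) * \<beta>" if "0 \<le> \<beta>" for \<beta>
    using that by (simp add: expo_eq_J_tilde[OF G] J_tilde_eq_psi)
  moreover have "0 \<le> (\<integral>v. v \<partial>?P)"
    using P.AE_pos by (intro integral_nonneg_AE) (auto elim!: eventually_mono)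
  ultimately show ?thesis by (rule not_expo_linear_bound[OF G])
qed

lemma emeasure_projected_zero:
  assumes "A \<in> sets borel" "A \<subseteq> {0<..}"
  shows "emeasure (projected_measure \<nu> 0) A = 0"
proof -
  have "0 \<notin> A" using assms by auto
  then show ?thesis using assms by (simp add: projected_measure_def emeasure_distr vimage_def)
qed

text \<open>Turns a condition on Borel subsets of the open half-line into an equality of measures,
  the form delivered by uniqueness; neither measure charges the rest of the line.\<close>

lemma positive_part_scale_iff:
  assumes "sets \<mu> = sets borel" "emeasure \<mu> {..0} = 0"
  shows "positive_part_measure \<nu> g = scale_measure (ennreal x) \<mu> \<longleftrightarrow>
    (\<forall>A\<in>sets borel. A \<subseteq> {0<..} \<longrightarrow> emeasure (projected_measure \<nu> g) A = ennreal x * emeasure \<mu> A)"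
    (is "?lhs \<longleftrightarrow> ?rhs")
proof
  assume l: ?lhs
  show ?rhs
  proof (intro ballI impI)
    fix A :: "real set" assume A: "A \<in> sets borel" "A \<subseteq> {0<..}"
    then have "A \<inter> {0<..} = A" by auto
    then have "emeasure (projected_measure \<nu> g) A = emeasure (positive_part_measure \<nu> g) A"
      using A by (simp add: emeasure_positive_part)
    then show "emeasure (projected_measure \<nu> g) A = ennreal x * emeasure \<mu> A"
      unfolding l by simp
  qed
next
  assume r: ?rhs
  show ?lhs
  proof (rule measure_eqI)
    show "sets (positive_part_measure \<nu> g) = sets (scale_measure (ennreal x) \<mu>)"
      by (simp add: sets_positive_part assms(1))
    fix A assume "A \<in> sets (positive_part_measure \<nu> g)"
    then have A: "A \<in> sets borel" by (simp add: sets_positive_part)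
    have "AE v in \<mu>. v \<notin> {..0}" using assms by (intro AE_not_in null_setsI) auto
    then have "emeasure \<mu> (A \<inter> {0<..}) = emeasure \<mu> A"
      using A assms(1) by (intro emeasure_eq_AE) (auto elim!: eventually_mono)
    moreover have "A \<inter> {0<..} \<in> sets borel" "A \<inter> {0<..} \<subseteq> {0<..}" using A by auto
    ultimately show "emeasure (positive_part_measure \<nu> g) A = emeasure (scale_measure (ennreal x) \<mu>) A"
      using r A by (simp add: emeasure_positive_part)
  qed
qed

lemma generating_pair_of_form_iff:
  assumes G: "\<And>x. 0 \<le> x \<Longrightarrow> 0 \<le> G x $ 1" "\<And>x. 0 \<le> x \<Longrightarrow> 0 \<le> G x $ 2"
  shows "generating_pair_of_form M Z Q \<nu> G F \<longleftrightarrow>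
    G 0 = 0 \<and> (\<forall>x\<ge>0. \<forall>\<beta>\<ge>0. J1 (\<beta> * G x $ 1) + J2 (\<beta> * G x $ 2) = x * F \<beta>)"
    (is "?lhs \<longleftrightarrow> ?rhs")
proof
  assume ?lhs
  then obtain c \<mu> where pair: "generating_pair_with M Z Q \<nu> G c \<mu>" and F: "\<And>\<beta>. 0 \<le> \<beta> \<Longrightarrow> J_tilde c \<mu> \<beta> = F \<beta>"
    unfolding generating_pair_of_form_def by blast
  have G0: "G 0 = 0" using generating_pair_zero[OF G(1)[OF order_refl] G(2)[OF order_refl] pair] .
  have sets: "sets \<mu> = sets borel" and null: "emeasure \<mu> {..0} = 0"
    using pair by (simp_all add: generating_pair_with_def)
  have "J1 (\<beta> * G x $ 1) + J2 (\<beta> * G x $ 2) = x * F \<beta>" if x: "0 \<le> x" and b: "0 \<le> \<beta>" for x \<beta>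
  proof -
    \<comment> \<open>With \<open>G 0 = 0\<close> the base term vanishes on the open half-line, and
      only x times \<mu> is left.\<close>
    have "positive_part_measure \<nu> (G x) = scale_measure (ennreal x) \<mu>"
      unfolding positive_part_scale_iff[OF sets null]
      using pair x emeasure_projected_zero by (simp add: generating_pair_with_def G0)
    moreover have "1/2 * ((Q *v G x) \<bullet> G x) = x * c"
      using pair x by (simp add: generating_pair_with_def mult.commute)
    ultimately have "expo (\<beta> *\<^sub>R G x) = x * J_tilde c \<mu> \<beta>"
      using G[OF x] by (simp only: expo_eq_J_tilde J_tilde_scale[OF sets x])
    then show ?thesis using G[OF x] b by (simp add: F expo_eq)
  qed
  then show ?rhs using G0 by simp
next
  assume r: ?rhs
  then have G0: "G 0 = 0" and eq: "\<And>x \<beta>. 0 \<le> x \<Longrightarrow> 0 \<le> \<beta> \<Longrightarrow> expo (\<beta> *\<^sub>R G x) = x * F \<beta>"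
    using G by (simp_all add: expo_eq)
  define c where "c = 1/2 * ((Q *v G 1) \<bullet> G 1)"
  define \<mu> where "\<mu> = positive_part_measure \<nu> (G 1)"
  have \<mu>: "levy_measure_on_Ioi \<mu>" unfolding \<mu>_def by (rule levy_measure_positive_part)
  then interpret L: levy_measure_on_Ioi \<mu> .
  have F: "J_tilde c \<mu> \<beta> = F \<beta>" if "0 \<le> \<beta>" for \<beta>
    using eq[of 1 \<beta>] that G[of 1] by (simp add: expo_eq_J_tilde c_def \<mu>_def)
  have scale: "1/2 * ((Q *v G x) \<bullet> G x) = x * c \<and> positive_part_measure \<nu> (G x) = scale_measure (ennreal x) \<mu>"
    if x: "0 \<le> x" for x
  proof (rule J_tilde_unique)
    show "levy_measure_on_Ioi (positive_part_measure \<nu> (G x))" by (rule levy_measure_positive_part)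
    have "(\<integral>\<^sup>+v. ennreal (min v (v\<^sup>2)) \<partial>scale_measure (ennreal x) \<mu>) < \<infinity>"
      using L.finite_min by (simp add: nn_integral_scale_measure ennreal_mult_less_top)
    then show "levy_measure_on_Ioi (scale_measure (ennreal x) \<mu>)"
      by unfold_locales (simp_all add: L.sets_\<mu> L.null_Iic)
    \<comment> \<open>Both sides equal \<open>x * F (real n)\<close>: the left by the equation at x,
      the right by the equation at 1.\<close>
    show "J_tilde (1/2 * ((Q *v G x) \<bullet> G x)) (positive_part_measure \<nu> (G x)) (real n)
      = J_tilde (x * c) (scale_measure (ennreal x) \<mu>) (real n)" for n
      using eq[OF x, of "real n"] G[OF x] x by (simp add: expo_eq_J_tilde J_tilde_scale L.sets_\<mu> F)
  qed
  have "generating_pair_with M Z Q \<nu> G c \<mu>"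
    unfolding generating_pair_with_def
  proof (intro conjI allI impI ballI)
    show "AE \<omega> in M. \<forall>x\<ge>0. \<forall>t\<ge>0. 0 \<le> G x \<bullet> jump (\<lambda>s. Z s \<omega>) t"
      using AE_jump_nonneg by eventually_elim (auto simp: inner_vec2 G)
    have "(\<integral>\<^sup>+v\<in>{0<..}. ennreal v \<partial>projected_measure \<nu> (G 0)) = 0"
      unfolding projected_measure_def G0 by (subst nn_integral_distr) auto
    then show "(\<integral>\<^sup>+v\<in>{0<..}. ennreal v \<partial>projected_measure \<nu> (G 0)) < \<infinity>" by simp
    show "0 \<le> c" using Q_nonneg[of "G 1"] by (simp add: c_def)
    show "sets \<mu> = sets borel" "emeasure \<mu> {..0} = 0" by (fact L.sets_\<mu> L.null_Iic)+
    show "(\<integral>\<^sup>+v. ennreal (min v (v\<^sup>2)) \<partial>\<mu>) < \<infinity>" by (fact L.finite_min)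
    fix x :: real assume x: "0 \<le> x"
    show "1/2 * ((Q *v G x) \<bullet> G x) = c * x" using scale[OF x] by (simp add: mult.commute)
    fix A :: "real set" assume "A \<in> sets borel" "A \<subseteq> {0<..}"
    then show "emeasure (projected_measure \<nu> (G x)) A
      = emeasure (projected_measure \<nu> (G 0)) A + ennreal x * emeasure \<mu> A"
      using scale[OF x] positive_part_scale_iff[OF L.sets_\<mu> L.null_Iic] emeasure_projected_zero
      by (simp add: G0)
  qed
  then show ?lhs unfolding generating_pair_of_form_def using F by blast
qed

end

section \<open>The classification\<close>

lemma powr_root_cancel:
  fixes a x :: real
  assumes "0 < a" "0 \<le> x"
  shows "(x powr (1 / a)) powr a = x" "(x powr a) powr (1 / a) = x"
  using assms by (simp_all add: powr_powr)

lemma c_stable_pos: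
  assumes "1 < a" "a \<le> 2"
  shows "0 < c_stable a"
  using assms Gamma_real_pos[of "2 - a"] by (auto simp: c_stable_def)

text \<open>At zero the two exponents agree because \<open>0 powr a = 0\<close>; the information
  lies in the positive arguments.\<close>

lemma has_laplace_exponent_powr_iff:
  fixes X :: "real \<Rightarrow> 'w \<Rightarrow> real"
  assumes X: "has_laplace_exponent M X {0..} J" and "J 0 = 0"
  shows "has_laplace_exponent M X {0..} (\<lambda>\<beta>. c * \<beta> powr a) \<longleftrightarrow> (\<forall>u>0. J u = c * u powr a)"
proof (intro iffI allI impI)
  fix u :: real assume "has_laplace_exponent M X {0..} (\<lambda>\<beta>. c * \<beta> powr a)" "0 < u"
  then show "J u = c * u powr a" using has_laplace_exponent_unique[OF X, of "\<lambda>\<beta>. c * \<beta> powr a" u] by simp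
next
  assume J: "\<forall>u>0. J u = c * u powr a"
  show "has_laplace_exponent M X {0..} (\<lambda>\<beta>. c * \<beta> powr a)"
  proof (rule has_laplace_exponent_cong[OF X])
    show "J l = c * l powr a" if "l \<in> {0..}" for l
      using J \<open>J 0 = 0\<close> that by (cases "l = 0") auto
  qed
qed

section \<open>Stability expressed by the coordinate exponents\<close>

context planar_levy_martingale
begin

text \<open>The martingale property and the sign of the jumps come from the locale, so stability
  reduces to the shape of the exponent.\<close>

lemma stable_coord_iff:
  assumes "1 < a" "a \<le> 2" "0 < c"
  shows "stable_process M a c (\<lambda>t \<omega>. Z t \<omega> $ 1) \<longleftrightarrow> (\<forall>u>0. J1 u = c * u powr a)"
    and "stable_process M a c (\<lambda>t \<omega>. Z t \<omega> $ 2) \<longleftrightarrow> (\<forall>u>0. J2 u = c * u powr a)"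
  using assms by (simp_all add: stable_process_def levy_martingale_coord nonneg has_laplace_exponent_powr_iff[OF laplace1 J_zero(1)]
      has_laplace_exponent_powr_iff[OF laplace2 J_zero(2)])

lemma stable_inner_iff:
  assumes "1 < a" "a \<le> 2" "0 < c" "0 \<le> g $ 1" "0 \<le> g $ 2"
  shows "stable_process M a c (\<lambda>t \<omega>. g \<bullet> Z t \<omega>) \<longleftrightarrow>
    (\<forall>u>0. J1 (u * g $ 1) + J2 (u * g $ 2) = c * u powr a)"
proof -
  have lap: "has_laplace_exponent M (\<lambda>t \<omega>. g \<bullet> Z t \<omega>) {0..} (\<lambda>\<beta>. J1 (\<beta> * g $ 1) + J2 (\<beta> * g $ 2))"
    using laplace_inner assms by simp
  have "J1 (0 * g $ 1) + J2 (0 * g $ 2) = 0" by (simp add: J_zero)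
  then show ?thesis
    using assms levy_martingale_inner[OF martingale] nonneg_jumps_inner
    by (simp add: stable_process_def has_laplace_exponent_powr_iff[OF lap])
qed

text \<open>For x = 0 or \<beta> = 0 both sides are 0. What remains is the range in which
  \<open>exponent_equation\<close> states the equation.\<close>

lemma generating_pair_of_form_iff_pos:
  assumes G: "\<And>x. 0 \<le> x \<Longrightarrow> 0 \<le> G x $ 1" "\<And>x. 0 \<le> x \<Longrightarrow> 0 \<le> G x $ 2" and "F 0 = 0"
  shows "generating_pair_of_form M Z Q \<nu> G F \<longleftrightarrow>
    G 0 = 0 \<and> (\<forall>x>0. \<forall>\<beta>>0. J1 (\<beta> * G x $ 1) + J2 (\<beta> * G x $ 2) = x * F \<beta>)"
proof -
  have "J1 (\<beta> * G x $ 1) + J2 (\<beta> * G x $ 2) = x * F \<beta>"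
    if "G 0 = 0" "\<forall>x>0. \<forall>\<beta>>0. J1 (\<beta> * G x $ 1) + J2 (\<beta> * G x $ 2) = x * F \<beta>" "0 \<le> x" "0 \<le> \<beta>"
    for x \<beta>
    using that \<open>F 0 = 0\<close> by (cases "x = 0"; cases "\<beta> = 0") (auto simp: J_zero)
  moreover have "generating_pair_of_form M Z Q \<nu> G F \<longleftrightarrow>
      G 0 = 0 \<and> (\<forall>x\<ge>0. \<forall>\<beta>\<ge>0. J1 (\<beta> * G x $ 1) + J2 (\<beta> * G x $ 2) = x * F \<beta>)"
    using G by (rule generating_pair_of_form_iff)
  ultimately show ?thesis by (metis less_imp_le)
qed

end

theorem theorem3p11:
  fixes M :: "'w measure"
    and Z :: "real \<Rightarrow> 'w \<Rightarrow> real^2"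
    and Q :: "real^2^2" and \<nu> :: "(real^2) measure"
    and G :: "real \<Rightarrow> real^2"
    and J\<^sub>1 J\<^sub>2 :: "real \<Rightarrow> real"
    and \<alpha>\<^sub>1 \<alpha>\<^sub>2 :: real
  assumes "continuous_on {0..} (\<lambda>x. G x $ 1)" and "continuous_on {0..} (\<lambda>x. G x $ 2)"
    and "\<And>x. x > 0 \<Longrightarrow> G x $ 1 > 0" and "\<And>x. x > 0 \<Longrightarrow> G x $ 2 > 0"
    and "(\<lambda>x. G x $ 2 / G x $ 1) C1_differentiable_on {0<..}"
    and "levy_martingale M Z"
    and "nonneg_jumps M (\<lambda>t \<omega>. Z t \<omega> $ 1)" and "nonneg_jumps M (\<lambda>t \<omega>. Z t \<omega> $ 2)"
    and "independent_processes M (\<lambda>t \<omega>. Z t \<omega> $ 1) (\<lambda>t \<omega>. Z t \<omega> $ 2)"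
    and "infinite_variation M (\<lambda>t \<omega>. Z t \<omega> $ 1)" and "infinite_variation M (\<lambda>t \<omega>. Z t \<omega> $ 2)"
    and "levy_characteristics M Z Q \<nu>"
    and "has_laplace_exponent M (\<lambda>t \<omega>. Z t \<omega> $ 1) {0..} J\<^sub>1"
    and "has_laplace_exponent M (\<lambda>t \<omega>. Z t \<omega> $ 2) {0..} J\<^sub>2"
    and "regularly_varying_at_0 J\<^sub>1 \<alpha>\<^sub>1" and "regularly_varying_at_0 J\<^sub>2 \<alpha>\<^sub>2"
    and "2 \<ge> \<alpha>\<^sub>1" and "\<alpha>\<^sub>1 \<ge> \<alpha>\<^sub>2" and "\<alpha>\<^sub>2 > 1"
  shows
    "(\<forall>\<eta>\<^sub>1>0.
        generating_pair_of_form M Z Q \<nu> G (\<lambda>\<beta>. \<eta>\<^sub>1 * \<beta> powr \<alpha>\<^sub>1) \<longleftrightarrow>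
          (\<exists>\<gamma>\<^sub>1>0. \<exists>\<gamma>\<^sub>2>0.
             (\<forall>x\<ge>0. G x = ((\<eta>\<^sub>1 / c_stable \<alpha>\<^sub>1) powr (1 / \<alpha>\<^sub>1) * x powr (1 / \<alpha>\<^sub>1)) *\<^sub>R vector [\<gamma>\<^sub>1, \<gamma>\<^sub>2]) \<and>
             stable_process M \<alpha>\<^sub>1 (c_stable \<alpha>\<^sub>1) (\<lambda>t \<omega>. \<gamma>\<^sub>1 * Z t \<omega> $ 1 + \<gamma>\<^sub>2 * Z t \<omega> $ 2)) \<or>
          (\<exists>c\<^sub>1>0. \<exists>c\<^sub>2>0.
             (\<forall>x\<ge>0. c\<^sub>1 * (G x $ 1) powr \<alpha>\<^sub>1 + c\<^sub>2 * (G x $ 2) powr \<alpha>\<^sub>1 = \<eta>\<^sub>1 * x) \<and>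
             stable_process M \<alpha>\<^sub>1 c\<^sub>1 (\<lambda>t \<omega>. Z t \<omega> $ 1) \<and>
             stable_process M \<alpha>\<^sub>1 c\<^sub>2 (\<lambda>t \<omega>. Z t \<omega> $ 2)))
     \<and>
     (\<alpha>\<^sub>1 > \<alpha>\<^sub>2 \<longrightarrow>
       (\<forall>\<eta>\<^sub>1>0. \<forall>\<eta>\<^sub>2>0.
          generating_pair_of_form M Z Q \<nu> G (\<lambda>\<beta>. \<eta>\<^sub>1 * \<beta> powr \<alpha>\<^sub>1 + \<eta>\<^sub>2 * \<beta> powr \<alpha>\<^sub>2) \<longleftrightarrow>
          (\<exists>c\<^sub>1>0. \<exists>d\<^sub>2>0.
             (\<forall>x\<ge>0. G x $ 1 = (\<eta>\<^sub>1 / c\<^sub>1 * x) powr (1 / \<alpha>\<^sub>1)) \<and>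
             (\<forall>x\<ge>0. G x $ 2 = (\<eta>\<^sub>2 / d\<^sub>2 * x) powr (1 / \<alpha>\<^sub>2)) \<and>
             stable_process M \<alpha>\<^sub>1 c\<^sub>1 (\<lambda>t \<omega>. Z t \<omega> $ 1) \<and>
             stable_process M \<alpha>\<^sub>2 d\<^sub>2 (\<lambda>t \<omega>. Z t \<omega> $ 2))))"
proof -
  interpret planar_levy_martingale M Z Q \<nu> "J\<^sub>1" "J\<^sub>2"
    using assms by unfold_locales
  note \<alpha> = \<open>2 \<ge> \<alpha>\<^sub>1\<close> \<open>\<alpha>\<^sub>1 \<ge> \<alpha>\<^sub>2\<close> \<open>\<alpha>\<^sub>2 > 1\<close>
  note G_pos = assms(3,4) and rv = assms(15,16)
  have \<alpha>1: "1 < \<alpha>\<^sub>1" "\<alpha>\<^sub>1 \<le> 2" "0 < \<alpha>\<^sub>1" and \<alpha>2: "1 < \<alpha>\<^sub>2" "\<alpha>\<^sub>2 \<le> 2" "0 < \<alpha>\<^sub>2" using \<alpha> by auto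
  \<comment> \<open>Positivity is given for x > 0; the limit from the right puts \<open>G 0\<close>
    as well into the orthant on which the exponents are defined.\<close>
  have G0_nonneg: "0 \<le> G 0 $ i" if "continuous_on {0..} (\<lambda>x. G x $ i)" "\<And>x. x > 0 \<Longrightarrow> G x $ i > 0" for i
  proof (rule tendsto_lowerbound)
    have "((\<lambda>x. G x $ i) \<longlongrightarrow> G 0 $ i) (at 0 within {0..})"
      using that(1) by (simp add: continuous_on)
    then show "((\<lambda>x. G x $ i) \<longlongrightarrow> G 0 $ i) (at_right 0)"
      by (rule tendsto_within_subset) auto
    show "\<forall>\<^sub>F x in at_right 0. 0 \<le> G x $ i"
      using eventually_at_right_less[of "0::real"] by eventually_elim (use that(2) in \<open>auto intro: less_imp_le\<close>)
  qed simp
  have G: "0 \<le> G x $ 1" "0 \<le> G x $ 2" if "0 \<le> x" for x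
    using that G0_nonneg[OF assms(1,3)] G0_nonneg[OF assms(2,4)] G_pos[of x] by (cases "x = 0"; simp add: less_imp_le)+
  have zero_iff: "G 0 = 0 \<longleftrightarrow> G 0 $ 1 = 0 \<and> G 0 $ 2 = 0"
    by (simp add: vec_eq_iff forall_2)
  have equation: "exponent_equation J\<^sub>1 J\<^sub>2 (\<lambda>x. G x $ 1) (\<lambda>x. G x $ 2) \<eta>1 \<eta>2 a b"
    if "0 < a" "0 < b"
      "\<And>x \<beta>. 0 < x \<Longrightarrow> 0 < \<beta> \<Longrightarrow> J\<^sub>1 (\<beta> * G x $ 1) + J\<^sub>2 (\<beta> * G x $ 2) = x * (\<eta>1 * \<beta> powr a + \<eta>2 * \<beta> powr b)"
    for \<eta>1 \<eta>2 a b
    using that G_pos J2_tendsto_0 J_nonneg by unfold_locales auto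
  let ?c = "c_stable \<alpha>\<^sub>1"
  have c: "0 < ?c" using c_stable_pos \<alpha>1 by simp
  have stable_sum: "stable_process M \<alpha>\<^sub>1 ?c (\<lambda>t \<omega>. \<gamma>\<^sub>1 * Z t \<omega> $ 1 + \<gamma>\<^sub>2 * Z t \<omega> $ 2) \<longleftrightarrow>
      (\<forall>u>0. J\<^sub>1 (u * \<gamma>\<^sub>1) + J\<^sub>2 (u * \<gamma>\<^sub>2) = ?c * u powr \<alpha>\<^sub>1)" if "0 < \<gamma>\<^sub>1" "0 < \<gamma>\<^sub>2" for \<gamma>\<^sub>1 \<gamma>\<^sub>2
    using stable_inner_iff[OF \<alpha>1(1,2) c, of "vector [\<gamma>\<^sub>1, \<gamma>\<^sub>2]"] that by (simp add: inner_vec2)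
  have one_power: "generating_pair_of_form M Z Q \<nu> G (\<lambda>\<beta>. \<eta> * \<beta> powr \<alpha>\<^sub>1) \<longleftrightarrow>
      (\<exists>\<gamma>\<^sub>1>0. \<exists>\<gamma>\<^sub>2>0.
         (\<forall>x\<ge>0. G x = ((\<eta> / ?c) powr (1 / \<alpha>\<^sub>1) * x powr (1 / \<alpha>\<^sub>1)) *\<^sub>R vector [\<gamma>\<^sub>1, \<gamma>\<^sub>2]) \<and>
         stable_process M \<alpha>\<^sub>1 ?c (\<lambda>t \<omega>. \<gamma>\<^sub>1 * Z t \<omega> $ 1 + \<gamma>\<^sub>2 * Z t \<omega> $ 2)) \<or>
      (\<exists>c\<^sub>1>0. \<exists>c\<^sub>2>0.
         (\<forall>x\<ge>0. c\<^sub>1 * (G x $ 1) powr \<alpha>\<^sub>1 + c\<^sub>2 * (G x $ 2) powr \<alpha>\<^sub>1 = \<eta> * x) \<and>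
         stable_process M \<alpha>\<^sub>1 c\<^sub>1 (\<lambda>t \<omega>. Z t \<omega> $ 1) \<and>
         stable_process M \<alpha>\<^sub>1 c\<^sub>2 (\<lambda>t \<omega>. Z t \<omega> $ 2))"
    (is "?pair \<longleftrightarrow> ?A \<or> ?B") if \<eta>: "0 < \<eta>" for \<eta>
  proof -
    have pair_iff: "?pair \<longleftrightarrow> G 0 = 0 \<and>
        (\<forall>x>0. \<forall>\<beta>>0. J\<^sub>1 (\<beta> * G x $ 1) + J\<^sub>2 (\<beta> * G x $ 2) = x * (\<eta> * \<beta> powr \<alpha>\<^sub>1))"
      by (rule generating_pair_of_form_iff_pos) (simp_all add: G)
    \<comment> \<open>The constant c_0 of case a). It satisfies
      \<open>?c * k powr \<alpha>\<^sub>1 = \<eta>\<close>, so scaling the argument by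
      \<open>k\<close> turns the coefficient \<open>?c\<close> into \<eta>.\<close>
    define k where "k = (\<eta> / ?c) powr (1 / \<alpha>\<^sub>1)"
    have k: "0 < k" "k powr \<alpha>\<^sub>1 = \<eta> / ?c" using \<eta> c \<alpha>1 by (simp_all add: k_def powr_root_cancel)
    show ?thesis
    proof
      assume ?pair
      then have G0: "G 0 = 0" and eq: "\<And>x \<beta>. 0 < x \<Longrightarrow> 0 < \<beta> \<Longrightarrow>
          J\<^sub>1 (\<beta> * G x $ 1) + J\<^sub>2 (\<beta> * G x $ 2) = x * (\<eta> * \<beta> powr \<alpha>\<^sub>1)"
        using pair_iff by auto
      interpret exponent_equation "J\<^sub>1" "J\<^sub>2" "\<lambda>x. G x $ 1" "\<lambda>x. G x $ 2" \<eta> 0 "\<alpha>\<^sub>1" "\<alpha>\<^sub>1"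
        using equation \<alpha>1 eq by simp
      have "(\<exists>r>0. \<forall>x>0. G x $ 2 = r * G x $ 1) \<or>
        (\<exists>c1>0. \<exists>c2>0. \<forall>u>0. J\<^sub>1 u = c1 * u powr \<alpha>\<^sub>1 \<and> J\<^sub>2 u = c2 * u powr \<alpha>\<^sub>1)"
        using one_power_cases[OF refl refl rv] .
      then show "?A \<or> ?B"
      proof (elim disjE exE conjE)
        fix r :: real assume r: "0 < r" "\<forall>x>0. G x $ 2 = r * G x $ 1"
        \<comment> \<open>Normalised so that \<open>G 1\<close> is \<open>k\<close> times the vector
          with entries \<gamma> and r \<gamma>, as the formula of case a) requires at x = 1.\<close>
        define \<gamma> where "\<gamma> = G 1 $ 1 / k"
        have \<gamma>: "0 < \<gamma>" "G 1 $ 1 = k * \<gamma>" using G_pos(1)[of 1] k by (simp_all add: \<gamma>_def)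
        \<comment> \<open>The equation at x = 1 with \<beta> = u / k; division by \<open>k\<close>
          brings the coefficient \<eta> back to \<open>?c\<close>.\<close>
        have H: "J\<^sub>1 (u * \<gamma>) + J\<^sub>2 (u * (r * \<gamma>)) = ?c * u powr \<alpha>\<^sub>1" if "0 < u" for u
        proof -
          have "J\<^sub>1 (u / k * G 1 $ 1) + J\<^sub>2 (u / k * G 1 $ 2) = \<eta> * (u / k) powr \<alpha>\<^sub>1"
            using eq[of 1 "u / k"] that k by simp
          moreover have "\<eta> * (u / k) powr \<alpha>\<^sub>1 = ?c * u powr \<alpha>\<^sub>1"
            using that k \<eta> c by (simp add: powr_divide)
          ultimately show ?thesis using r \<gamma> k by (simp add: mult.left_commute)
        qed
        have G1: "G x $ 1 = k * x powr (1 / \<alpha>\<^sub>1) * \<gamma>" if x: "0 < x" for x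
        proof -
          define w where "w = G x $ 1 / \<gamma>"
          have w: "0 < w" "G x $ 1 = w * \<gamma>" "G x $ 2 = w * (r * \<gamma>)"
            using G_pos(1)[OF x] \<gamma> r x by (simp_all add: w_def)
          \<comment> \<open>The equation at \<beta> = 1 and \<open>H\<close> at \<open>w\<close>
            evaluate the same sum of exponents.\<close>
          have "?c * w powr \<alpha>\<^sub>1 = x * \<eta>" using eq[OF x, of 1] H[OF w(1)] w by simp
          then have "w powr \<alpha>\<^sub>1 = \<eta> / ?c * x" using c by (simp add: field_simps)
          then have "w = (\<eta> / ?c * x) powr (1 / \<alpha>\<^sub>1)"
            using powr_root_cancel(2)[of "\<alpha>\<^sub>1" w] w \<alpha>1 by simp
          also have "\<dots> = k * x powr (1 / \<alpha>\<^sub>1)" unfolding k_def by (rule powr_mult)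
          finally show ?thesis using w by simp
        qed
        have "G x = (k * x powr (1 / \<alpha>\<^sub>1)) *\<^sub>R vector [\<gamma>, r * \<gamma>]" if "0 \<le> x" for x
          using that G1[of x] r(2) G0 by (cases "x = 0") (auto simp: vec_eq_iff forall_2)
        moreover have "stable_process M \<alpha>\<^sub>1 ?c (\<lambda>t \<omega>. \<gamma> * Z t \<omega> $ 1 + r * \<gamma> * Z t \<omega> $ 2)"
          using stable_sum[of \<gamma> "r * \<gamma>"] H \<gamma> r by simp
        moreover have "0 < r * \<gamma>" using \<gamma> r by simp
        ultimately have ?A using \<gamma>(1) unfolding k_def by blast
        then show ?thesis ..
      next
        fix c1 c2 :: real
        assume c12: "0 < c1" "0 < c2"
          and J: "\<forall>u>0. J\<^sub>1 u = c1 * u powr \<alpha>\<^sub>1 \<and> J\<^sub>2 u = c2 * u powr \<alpha>\<^sub>1"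
        have "c1 * (G x $ 1) powr \<alpha>\<^sub>1 + c2 * (G x $ 2) powr \<alpha>\<^sub>1 = \<eta> * x" if "0 \<le> x" for x
          using eq[of x 1] J G_pos[of x] that G0 by (cases "x = 0") auto
        moreover have "stable_process M \<alpha>\<^sub>1 c1 (\<lambda>t \<omega>. Z t \<omega> $ 1)" "stable_process M \<alpha>\<^sub>1 c2 (\<lambda>t \<omega>. Z t \<omega> $ 2)"
          using stable_coord_iff[OF \<alpha>1(1,2)] c12 J by simp_all
        ultimately have ?B using c12 by blast
        then show ?thesis ..
      qed
    next
      assume "?A \<or> ?B"
      then show ?pair
      proof
        assume ?A
        then obtain \<gamma>\<^sub>1 \<gamma>\<^sub>2 where \<gamma>: "0 < \<gamma>\<^sub>1" "0 < \<gamma>\<^sub>2"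
          and Gx: "\<And>x. 0 \<le> x \<Longrightarrow> G x = (k * x powr (1 / \<alpha>\<^sub>1)) *\<^sub>R vector [\<gamma>\<^sub>1, \<gamma>\<^sub>2]"
          and st: "stable_process M \<alpha>\<^sub>1 ?c (\<lambda>t \<omega>. \<gamma>\<^sub>1 * Z t \<omega> $ 1 + \<gamma>\<^sub>2 * Z t \<omega> $ 2)"
          unfolding k_def by blast
        have "J\<^sub>1 (\<beta> * G x $ 1) + J\<^sub>2 (\<beta> * G x $ 2) = x * (\<eta> * \<beta> powr \<alpha>\<^sub>1)" if "0 < x" "0 < \<beta>" for x \<beta>
        proof -
          have "J\<^sub>1 ((\<beta> * (k * x powr (1 / \<alpha>\<^sub>1))) * \<gamma>\<^sub>1) + J\<^sub>2 ((\<beta> * (k * x powr (1 / \<alpha>\<^sub>1))) * \<gamma>\<^sub>2)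
            = ?c * (\<beta> * (k * x powr (1 / \<alpha>\<^sub>1))) powr \<alpha>\<^sub>1"
            using st stable_sum[OF \<gamma>] that k by simp
          moreover have "(\<beta> * (k * x powr (1 / \<alpha>\<^sub>1))) powr \<alpha>\<^sub>1 = \<beta> powr \<alpha>\<^sub>1 * (\<eta> / ?c * x)"
            using that k \<alpha>1 by (simp add: powr_mult powr_root_cancel)
          ultimately show ?thesis using that c by (simp add: Gx mult.assoc)
        qed
        moreover have "G 0 = 0" using Gx[of 0] by simp
        ultimately show ?pair using pair_iff by blast
      next
        assume ?B
        then obtain c1 c2 where c12: "0 < c1" "0 < c2"
          and Gx: "\<And>x. 0 \<le> x \<Longrightarrow> c1 * (G x $ 1) powr \<alpha>\<^sub>1 + c2 * (G x $ 2) powr \<alpha>\<^sub>1 = \<eta> * x"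
          and st: "stable_process M \<alpha>\<^sub>1 c1 (\<lambda>t \<omega>. Z t \<omega> $ 1)" "stable_process M \<alpha>\<^sub>1 c2 (\<lambda>t \<omega>. Z t \<omega> $ 2)"
          by blast
        have J: "J\<^sub>1 u = c1 * u powr \<alpha>\<^sub>1" "J\<^sub>2 u = c2 * u powr \<alpha>\<^sub>1" if "0 < u" for u
          using st stable_coord_iff[OF \<alpha>1(1,2)] c12 that by simp_all
        have "J\<^sub>1 (\<beta> * G x $ 1) + J\<^sub>2 (\<beta> * G x $ 2) = x * (\<eta> * \<beta> powr \<alpha>\<^sub>1)" if "0 < x" "0 < \<beta>" for x \<beta>
        proof -
          have "J\<^sub>1 (\<beta> * G x $ 1) + J\<^sub>2 (\<beta> * G x $ 2)
            = \<beta> powr \<alpha>\<^sub>1 * (c1 * (G x $ 1) powr \<alpha>\<^sub>1 + c2 * (G x $ 2) powr \<alpha>\<^sub>1)"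
            using that G_pos[of x] by (simp add: J powr_mult algebra_simps)
          then show ?thesis using Gx[of x] that by simp
        qed
        \<comment> \<open>At x = 0 the identity makes a sum of two nonnegative terms vanish, and a
          power is zero only for base zero.\<close>
        moreover have "G 0 = 0"
        proof -
          have "0 \<le> c1 * (G 0 $ 1) powr \<alpha>\<^sub>1" "0 \<le> c2 * (G 0 $ 2) powr \<alpha>\<^sub>1" using c12 by simp_all
          moreover have "c1 * (G 0 $ 1) powr \<alpha>\<^sub>1 + c2 * (G 0 $ 2) powr \<alpha>\<^sub>1 = 0" using Gx[of 0] by simp
          ultimately have "c1 * (G 0 $ 1) powr \<alpha>\<^sub>1 = 0" "c2 * (G 0 $ 2) powr \<alpha>\<^sub>1 = 0" by linarith+
          then have "G 0 $ 1 = 0" "G 0 $ 2 = 0" using c12 by auto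
          then show ?thesis unfolding zero_iff ..
        qed
        ultimately show ?pair using pair_iff by blast
      qed
    qed
  qed
  have two_powers: "generating_pair_of_form M Z Q \<nu> G (\<lambda>\<beta>. \<eta> * \<beta> powr \<alpha>\<^sub>1 + \<theta> * \<beta> powr \<alpha>\<^sub>2) \<longleftrightarrow>
      (\<exists>c\<^sub>1>0. \<exists>d\<^sub>2>0.
         (\<forall>x\<ge>0. G x $ 1 = (\<eta> / c\<^sub>1 * x) powr (1 / \<alpha>\<^sub>1)) \<and>
         (\<forall>x\<ge>0. G x $ 2 = (\<theta> / d\<^sub>2 * x) powr (1 / \<alpha>\<^sub>2)) \<and>
         stable_process M \<alpha>\<^sub>1 c\<^sub>1 (\<lambda>t \<omega>. Z t \<omega> $ 1) \<and>
         stable_process M \<alpha>\<^sub>2 d\<^sub>2 (\<lambda>t \<omega>. Z t \<omega> $ 2))"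
    (is "?pair \<longleftrightarrow> ?C") if \<eta>: "0 < \<eta>" "0 < \<theta>" and lt: "\<alpha>\<^sub>2 < \<alpha>\<^sub>1" for \<eta> \<theta>
  proof -
    have pair_iff: "?pair \<longleftrightarrow> G 0 = 0 \<and>
        (\<forall>x>0. \<forall>\<beta>>0. J\<^sub>1 (\<beta> * G x $ 1) + J\<^sub>2 (\<beta> * G x $ 2) = x * (\<eta> * \<beta> powr \<alpha>\<^sub>1 + \<theta> * \<beta> powr \<alpha>\<^sub>2))"
      by (rule generating_pair_of_form_iff_pos) (simp_all add: G)
    show ?thesis
    proof
      assume ?pair
      then have G0: "G 0 = 0" and eq: "\<And>x \<beta>. 0 < x \<Longrightarrow> 0 < \<beta> \<Longrightarrow>
          J\<^sub>1 (\<beta> * G x $ 1) + J\<^sub>2 (\<beta> * G x $ 2) = x * (\<eta> * \<beta> powr \<alpha>\<^sub>1 + \<theta> * \<beta> powr \<alpha>\<^sub>2)"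
        using pair_iff by auto
      interpret exponent_equation "J\<^sub>1" "J\<^sub>2" "\<lambda>x. G x $ 1" "\<lambda>x. G x $ 2" \<eta> \<theta> "\<alpha>\<^sub>1" "\<alpha>\<^sub>2"
        using equation \<alpha>1 \<alpha>2 eq by simp
      \<comment> \<open>The fact \<open>two_powers\<close> used here is that of the interpreted
        \<open>exponent_equation\<close>, not the equivalence under proof.\<close>
      obtain c1 d2 where cd: "0 < c1" "0 < d2"
        and J: "\<And>u. 0 < u \<Longrightarrow> J\<^sub>1 u = c1 * u powr \<alpha>\<^sub>1" "\<And>u. 0 < u \<Longrightarrow> J\<^sub>2 u = d2 * u powr \<alpha>\<^sub>2"
        and Gx: "\<And>x. 0 < x \<Longrightarrow> G x $ 1 = (\<eta> / c1 * x) powr (1 / \<alpha>\<^sub>1)"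
          "\<And>x. 0 < x \<Longrightarrow> G x $ 2 = (\<theta> / d2 * x) powr (1 / \<alpha>\<^sub>2)"
        using two_powers[OF \<eta> lt rv(1)] by blast
      have "G x $ 1 = (\<eta> / c1 * x) powr (1 / \<alpha>\<^sub>1)" "G x $ 2 = (\<theta> / d2 * x) powr (1 / \<alpha>\<^sub>2)" if "0 \<le> x" for x
        using that G0 Gx[of x] by (cases "x = 0"; simp)+
      moreover have "stable_process M \<alpha>\<^sub>1 c1 (\<lambda>t \<omega>. Z t \<omega> $ 1)" "stable_process M \<alpha>\<^sub>2 d2 (\<lambda>t \<omega>. Z t \<omega> $ 2)"
        using stable_coord_iff(1)[OF \<alpha>1(1,2)] stable_coord_iff(2)[OF \<alpha>2(1,2)] cd J by simp_all
      ultimately show ?C using cd by blast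
    next
      assume ?C
      then obtain c1 d2 where cd: "0 < c1" "0 < d2"
        and Gx: "\<And>x. 0 \<le> x \<Longrightarrow> G x $ 1 = (\<eta> / c1 * x) powr (1 / \<alpha>\<^sub>1)"
          "\<And>x. 0 \<le> x \<Longrightarrow> G x $ 2 = (\<theta> / d2 * x) powr (1 / \<alpha>\<^sub>2)"
        and st: "stable_process M \<alpha>\<^sub>1 c1 (\<lambda>t \<omega>. Z t \<omega> $ 1)" "stable_process M \<alpha>\<^sub>2 d2 (\<lambda>t \<omega>. Z t \<omega> $ 2)"
        by blast
      have J: "J\<^sub>1 u = c1 * u powr \<alpha>\<^sub>1" "J\<^sub>2 u = d2 * u powr \<alpha>\<^sub>2" if "0 < u" for u
        using st stable_coord_iff(1)[OF \<alpha>1(1,2)] stable_coord_iff(2)[OF \<alpha>2(1,2)] cd that by simp_all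
      have "J\<^sub>1 (\<beta> * G x $ 1) + J\<^sub>2 (\<beta> * G x $ 2) = x * (\<eta> * \<beta> powr \<alpha>\<^sub>1 + \<theta> * \<beta> powr \<alpha>\<^sub>2)"
        if x: "0 < x" and b: "0 < \<beta>" for x \<beta>
      proof -
        have "(G x $ 1) powr \<alpha>\<^sub>1 = \<eta> / c1 * x" "(G x $ 2) powr \<alpha>\<^sub>2 = \<theta> / d2 * x"
          using Gx[of x] x \<eta> cd \<alpha>1 \<alpha>2 by (simp_all add: powr_root_cancel)
        moreover have "J\<^sub>1 (\<beta> * G x $ 1) = c1 * (\<beta> powr \<alpha>\<^sub>1 * (G x $ 1) powr \<alpha>\<^sub>1)"
          "J\<^sub>2 (\<beta> * G x $ 2) = d2 * (\<beta> powr \<alpha>\<^sub>2 * (G x $ 2) powr \<alpha>\<^sub>2)"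
          using J G_pos[OF x] b by (simp_all add: powr_mult)
        ultimately show ?thesis using cd by (simp add: algebra_simps)
      qed
      moreover have "G 0 = 0" using Gx[of 0] by (simp add: zero_iff)
      ultimately show ?pair using pair_iff by blast
    qed
  qed
  show ?thesis by (intro conjI allI impI) (rule one_power two_powers; assumption)+
qed

end
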